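(* Let $T>0$ and let $\Omega\subset\mathbb{R}^n$ be a domain with the following property: for any $z\in\partial\Omega$ and any $s>0$ small, there exist $\nu\in C(\overline{\Omega}\cap B_s(z);\mathbb{R}^n)$ and $c>0$ small such that $B_{c\tau}(y+\tau\nu(y))\subset\Omega$ for all $y\in\overline{\Omega}\cap B_s(z)$ and $0<\tau\le c$. Let $H\in C(\Omega\times\mathbb{R}\times\mathbb{R}^n\times\mathbb{S}^n)$ be an elliptic operator, i.e. $H(x,r,p,X)\le H(x,r,p,Y)$ for all $x\in\Omega$, $r\in\mathbb{R}$, $p\in\mathbb{R}^n$ and $X,Y\in\mathbb{S}^n$ with $X\ge Y$. Assume that there exists $G\in C(\partial\Omega\times\mathbb{R})$ such that for any modulus of continuity $\omega$, $$\sup\{|H(x,r,p,X)-G(y,r)|:\ x\in\Omega,\ y\in\partial\Omega,\ |x-y|\le\delta,\ r\in\mathbb{R},\ |p|\le\omega(\delta)/\delta,\ |X|\le\omega(\delta)/\delta^2\}\to0\quad\text{as }\delta\to0.$$ Let $u\in C(\Omega\times(0,T))$ be a viscosity solution of $$u_t+H(x,u,\nabla u,\nabla^2u)=0\quad\text{in }\Omega\times(0,T)$$ that can be extended continuously to $\partial\Omega\times(0,T)$. Then $u\in C(\overline{\Omega}\times(0,T))$ satisfies $u_t+G(x,u)=0$ on $\partial\Omega\times(0,T)$ in the following sense. 1) Whenever $\varphi\in C^2(\overline{\Omega}\times(0,T))$ and $(x_0,t_0)\in\partial\Omega\times(0,T)$ are such that $u-\varphi$ attains a local maximum in $\overline{\Omega}\times(0,T)$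 at $(x_0,t_0)$, there holds $\varphi_t(x_0,t_0)+G(x_0,u(x_0,t_0))\le0$. 2) Whenever $\varphi\in C^2(\overline{\Omega}\times(0,T))$ and $(x_0,t_0)\in\partial\Omega\times(0,T)$ are such that $u-\varphi$ attains a local minimum in $\overline{\Omega}\times(0,T)$ at $(x_0,t_0)$, there holds $\varphi_t(x_0,t_0)+G(x_0,u(x_0,t_0))\ge0$.
   Context: $\mathbb{S}^n$ is the set of all real symmetric $n\times n$ matrices with the usual partial order; $B_r(x)$ is the open ball centered at $x$ with radius $r$; $\nabla,\nabla^2$ are the gradient and Hessian in the space variable; $\Omega_T=\Omega\times(0,T)$. A modulus of continuity is a nonnegative increasing function $\omega\in C([0,\infty))$ with $\omega(0)=0$. Viscosity solutions. A locally bounded upper (resp. lower) semicontinuous function $u$ in $\Omega_T$ is a viscosity subsolution (resp. supersolution) of $u_t+H(x,u,\nabla u,\nabla^2u)=0$ in $\Omega_T$ if whenever $(y,s)\in\Omega_T$ and $\varphi\in C^2(\Omega_T)$ are such that $u-\varphi$ attains a local maximum (resp. minimum) at $(y,s)$, one has $\varphi_t(y,s)+H(y,u(y,s),\nabla\varphi(y,s),\nabla^2\varphi(y,s))\le0$ (resp. $\ge0$). A continuous function is a viscosity solution if it is both a viscosity subsolution and a viscosity supersolution. *)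

theory Defs
  imports "HOL-Analysis.Analysis"
begin

definition domain_set :: "'a::euclidean_space set \<Rightarrow> bool" where
  "domain_set \<Omega> \<longleftrightarrow> open \<Omega> \<and> connected \<Omega> \<and> \<Omega> \<noteq> {}"

(* "any s > 0 small" is read as "every sufficiently small s > 0". *)
definition interior_cone_property :: "'a::euclidean_space set \<Rightarrow> bool" where
  "interior_cone_property \<Omega> \<longleftrightarrow>
     (\<forall>z\<in>frontier \<Omega>. \<forall>\<^sub>F s in at_right 0.
        \<exists>(\<nu> :: 'a \<Rightarrow> 'a) c. continuous_on (closure \<Omega> \<inter> ball z s) \<nu> \<and> c > 0 \<and>
          (\<forall>y\<in>closure \<Omega> \<inter> ball z s. \<forall>\<tau>. 0 < \<tau> \<and> \<tau> \<le> c \<longrightarrow>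
             ball (y + \<tau> *\<^sub>R \<nu> y) (c * \<tau>) \<subseteq> \<Omega>))"

(* A modulus is only constrained on [0, \<infinity>); "increasing" means nondecreasing. *)
definition modulus_of_continuity :: "(real \<Rightarrow> real) \<Rightarrow> bool" where
  "modulus_of_continuity \<omega> \<longleftrightarrow>
     continuous_on {0..} \<omega> \<and> mono_on {0..} \<omega> \<and> (\<forall>r\<ge>0. 0 \<le> \<omega> r) \<and> \<omega> 0 = 0"

definition sym_matrices :: "(real ^ 'n ^ 'n) set" where
  "sym_matrices = {X. transpose X = X}"

definition loewner_le :: "real ^ 'n ^ 'n \<Rightarrow> real ^ 'n ^ 'n \<Rightarrow> bool" where
  "loewner_le X Y \<longleftrightarrow> (\<forall>v. v \<bullet> (X *v v) \<le> v \<bullet> (Y *v v))"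

definition elliptic_on ::
  "(real ^ 'n) set \<Rightarrow> (real ^ 'n \<Rightarrow> real \<Rightarrow> real ^ 'n \<Rightarrow> real ^ 'n ^ 'n \<Rightarrow> real) \<Rightarrow> bool" where
  "elliptic_on \<Omega> H \<longleftrightarrow>
     (\<forall>x\<in>\<Omega>. \<forall>r p. \<forall>X\<in>sym_matrices. \<forall>Y\<in>sym_matrices.
        loewner_le Y X \<longrightarrow> H x r p X \<le> H x r p Y)"

(* The supremum is taken in [0, \<infinity>], so that it is meaningful even when the set of
   values is unbounded or empty. The norm on matrices is the Euclidean (Frobenius) one; for
   the condition that this gap tends to 0 as \<delta> \<rightarrow> 0 for every modulus \<omega>, the choice of norm is immaterial. *)
definition boundary_gap ::
  "(real ^ 'n) set \<Rightarrow> (real ^ 'n \<Rightarrow> real \<Rightarrow> real ^ 'n \<Rightarrow> real ^ 'n ^ 'n \<Rightarrow> real) \<Rightarrow>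
   (real ^ 'n \<Rightarrow> real \<Rightarrow> real) \<Rightarrow> (real \<Rightarrow> real) \<Rightarrow> real \<Rightarrow> ennreal" where
  "boundary_gap \<Omega> H G \<omega> \<delta> =
     (SUP (x, y, r, p, X) \<in> {(x, y, r, p, X). x \<in> \<Omega> \<and> y \<in> frontier \<Omega> \<and> norm (x - y) \<le> \<delta> \<and>
          X \<in> sym_matrices \<and> norm p \<le> \<omega> \<delta> / \<delta> \<and> norm X \<le> \<omega> \<delta> / \<delta>\<^sup>2}.
        ennreal \<bar>H x r p X - G y r\<bar>)"

definition local_max_on :: "'a::topological_space set \<Rightarrow> ('a \<Rightarrow> real) \<Rightarrow> 'a \<Rightarrow> bool" where
  "local_max_on S f z \<longleftrightarrow> z \<in> S \<and> (\<forall>\<^sub>F w in at z within S. f w \<le> f z)"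

definition local_min_on :: "'a::topological_space set \<Rightarrow> ('a \<Rightarrow> real) \<Rightarrow> 'a \<Rightarrow> bool" where
  "local_min_on S f z \<longleftrightarrow> z \<in> S \<and> (\<forall>\<^sub>F w in at z within S. f z \<le> f w)"

definition usc_on :: "'a::topological_space set \<Rightarrow> ('a \<Rightarrow> real) \<Rightarrow> bool" where
  "usc_on S f \<longleftrightarrow> (\<forall>z\<in>S. \<forall>c > f z. \<forall>\<^sub>F w in at z within S. f w < c)"

definition lsc_on :: "'a::topological_space set \<Rightarrow> ('a \<Rightarrow> real) \<Rightarrow> bool" where
  "lsc_on S f \<longleftrightarrow> (\<forall>z\<in>S. \<forall>c < f z. \<forall>\<^sub>F w in at z within S. c < f w)"

definition locally_bounded_on :: "'a::metric_space set \<Rightarrow> ('a \<Rightarrow> real) \<Rightarrow> bool" where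
  "locally_bounded_on S f \<longleftrightarrow> (\<forall>z\<in>S. \<exists>e>0. bounded (f ` (S \<inter> ball z e)))"

(* C^2 on the open set U, with the function and all its derivatives of order at most 2
   extending continuously to K, where U \<subseteq> K \<subseteq> closure U: g is the gradient of \<phi>,
   and h z v is the derivative of g at z in direction v. *)
definition C2_up_to ::
  "'a::euclidean_space set \<Rightarrow> 'a set \<Rightarrow> ('a \<Rightarrow> real) \<Rightarrow> bool" where
  "C2_up_to U K \<phi> \<longleftrightarrow> continuous_on K \<phi> \<and>
     (\<exists>(g :: 'a \<Rightarrow> 'a) (h :: 'a \<Rightarrow> 'a \<Rightarrow> 'a).
        continuous_on K g \<and> (\<forall>v. continuous_on K (\<lambda>z. h z v)) \<and>
        (\<forall>z\<in>U. GDERIV \<phi> z :> g z \<and> (g has_derivative h z) (at z)))"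

definition C2_on :: "'a::euclidean_space set \<Rightarrow> ('a \<Rightarrow> real) \<Rightarrow> bool" where
  "C2_on U \<phi> \<longleftrightarrow> C2_up_to U U \<phi>"

(* For \<phi> of class C^2 up to closure \<Omega> \<times> (0, T) this derivative also exists at points
   (x, t) with x on the boundary, and equals there the continuous extension of \<phi>_t from the
   interior: let the interior point tend to x, using locally uniform convergence of \<phi>_t in t. *)
definition time_deriv :: "((real ^ 'n) \<times> real \<Rightarrow> real) \<Rightarrow> real ^ 'n \<Rightarrow> real \<Rightarrow> real" where
  "time_deriv \<phi> x t = deriv (\<lambda>s. \<phi> (x, s)) t"

definition space_grad :: "((real ^ 'n) \<times> real \<Rightarrow> real) \<Rightarrow> real ^ 'n \<Rightarrow> real \<Rightarrow> real ^ 'n" where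
  "space_grad \<phi> x t = (\<chi> i. deriv (\<lambda>a. \<phi> (x + a *\<^sub>R axis i 1, t)) 0)"

definition space_hess :: "((real ^ 'n) \<times> real \<Rightarrow> real) \<Rightarrow> real ^ 'n \<Rightarrow> real \<Rightarrow> real ^ 'n ^ 'n" where
  "space_hess \<phi> x t = (\<chi> i j. deriv (\<lambda>a. space_grad \<phi> (x + a *\<^sub>R axis j 1) t $ i) 0)"

definition viscosity_subsolution ::
  "(real ^ 'n) set \<Rightarrow> real \<Rightarrow> (real ^ 'n \<Rightarrow> real \<Rightarrow> real ^ 'n \<Rightarrow> real ^ 'n ^ 'n \<Rightarrow> real) \<Rightarrow>
   ((real ^ 'n) \<times> real \<Rightarrow> real) \<Rightarrow> bool" where
  "viscosity_subsolution \<Omega> T H u \<longleftrightarrow>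
     locally_bounded_on (\<Omega> \<times> {0<..<T}) u \<and> usc_on (\<Omega> \<times> {0<..<T}) u \<and>
     (\<forall>\<phi> y s. C2_on (\<Omega> \<times> {0<..<T}) \<phi> \<and>
        local_max_on (\<Omega> \<times> {0<..<T}) (\<lambda>z. u z - \<phi> z) (y, s) \<longrightarrow>
        time_deriv \<phi> y s + H y (u (y, s)) (space_grad \<phi> y s) (space_hess \<phi> y s) \<le> 0)"

definition viscosity_supersolution ::
  "(real ^ 'n) set \<Rightarrow> real \<Rightarrow> (real ^ 'n \<Rightarrow> real \<Rightarrow> real ^ 'n \<Rightarrow> real ^ 'n ^ 'n \<Rightarrow> real) \<Rightarrow>
   ((real ^ 'n) \<times> real \<Rightarrow> real) \<Rightarrow> bool" where
  "viscosity_supersolution \<Omega> T H u \<longleftrightarrow>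
     locally_bounded_on (\<Omega> \<times> {0<..<T}) u \<and> lsc_on (\<Omega> \<times> {0<..<T}) u \<and>
     (\<forall>\<phi> y s. C2_on (\<Omega> \<times> {0<..<T}) \<phi> \<and>
        local_min_on (\<Omega> \<times> {0<..<T}) (\<lambda>z. u z - \<phi> z) (y, s) \<longrightarrow>
        time_deriv \<phi> y s + H y (u (y, s)) (space_grad \<phi> y s) (space_hess \<phi> y s) \<ge> 0)"

definition viscosity_solution ::
  "(real ^ 'n) set \<Rightarrow> real \<Rightarrow> (real ^ 'n \<Rightarrow> real \<Rightarrow> real ^ 'n \<Rightarrow> real ^ 'n ^ 'n \<Rightarrow> real) \<Rightarrow>
   ((real ^ 'n) \<times> real \<Rightarrow> real) \<Rightarrow> bool" where
  "viscosity_solution \<Omega> T H u \<longleftrightarrow>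
     continuous_on (\<Omega> \<times> {0<..<T}) u \<and>
     viscosity_subsolution \<Omega> T H u \<and> viscosity_supersolution \<Omega> T H u"

end

theory Submission
  imports Defs
begin

text \<open>
  For small \<open>\<delta>\<close> the cone property at the boundary point \<open>x\<^sub>0\<close> gives a ball of radius \<open>c \<delta>\<close>
  around \<open>b = x\<^sub>0 + \<delta> \<nu>(x\<^sub>0)\<close> inside \<open>\<Omega>\<close>. If \<open>u - \<phi>\<close> has a local maximum at \<open>(x\<^sub>0, t\<^sub>0)\<close> and \<open>E(\<delta>)\<close> is
  the deviation of \<open>u - \<phi>\<close> at \<open>(b, t\<^sub>0)\<close> from that maximum, then subtracting
  \<open>(t - t\<^sub>0)\<^sup>2 + (E(\<delta>) + \<delta>) |x - b|\<^sup>2 / (c \<delta>)\<^sup>2\<close> forces a maximum inside the ball, at a time close to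
  \<open>t\<^sub>0\<close>. The equation holds there with gradient and Hessian of orders \<open>o(1) / \<delta>\<close> and
  \<open>o(1) / \<delta>\<^sup>2\<close>, so \<open>H\<close> may be replaced by \<open>G\<close> in the limit \<open>\<delta> \<rightarrow> 0\<close>. The assertion on minima
  follows by applying this to \<open>- u\<close> and \<open>- H(x, - r, - p, - X)\<close>.
\<close>

section \<open>Second-order differences and symmetry of the second derivative\<close>

text \<open>The mean value theorem, applied along \<open>w\<close> to the difference of two parallel
  slices of \<phi>, turns the mixed difference into \<open>s\<close> times a difference of
  gradients. Expanding both gradients to first order at \<open>z\<close> leaves two remainders, each
  at most \<epsilon> times a displacement of size \<open>s * N\<close>; they account for the factor
  2.\<close>

lemma mixed_difference_bound:
  fixes \<phi> :: "'a::euclidean_space \<Rightarrow> real"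
  assumes "open U" "z \<in> U" and D: "\<And>w. w \<in> U \<Longrightarrow> GDERIV \<phi> w :> g w"
    and g: "(g has_derivative h) (at z)" and "\<epsilon> > 0"
  shows "\<forall>\<^sub>F s in at_right 0.
    \<bar>\<phi> (z + s *\<^sub>R v + s *\<^sub>R w) - \<phi> (z + s *\<^sub>R v) - \<phi> (z + s *\<^sub>R w) + \<phi> z - s\<^sup>2 * (h v \<bullet> w)\<bar>
      \<le> 2 * \<epsilon> * (norm v + norm w)\<^sup>2 * s\<^sup>2"
proof -
  define N where "N = norm v + norm w"
  have lin: "linear h"
    using g has_derivative_linear by blast
  obtain d1 where d1: "d1 > 0" "ball z d1 \<subseteq> U"
    using assms by (meson open_contains_ball)
  obtain d2 where d2: "d2 > 0"
    "\<And>k. norm k < d2 \<Longrightarrow> norm (g (z + k) - g z - h k) \<le> \<epsilon> * norm k"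
  proof -
    from g[unfolded has_derivative_at_alt] \<open>\<epsilon> > 0\<close> obtain d where "d > 0"
      "\<And>y. norm (y - z) < d \<Longrightarrow> norm (g y - g z - h (y - z)) \<le> \<epsilon> * norm (y - z)"
      by blast
    then show ?thesis
      using that[of d] by (metis add_diff_cancel_left')
  qed
  \<comment> \<open>All displacements below have norm at most \<open>s * N\<close>, so
    \<open>s < d\<close> keeps them inside both radii; the summand 1 covers the case
    \<open>N = 0\<close>.\<close>
  define d where "d = min d1 d2 / (N + 1)"
  have N0: "N \<ge> 0"
    by (simp add: N_def)
  have "d > 0"
    using d1 d2 N0 by (simp add: d_def)
  have "\<bar>\<phi> (z + s *\<^sub>R v + s *\<^sub>R w) - \<phi> (z + s *\<^sub>R v) - \<phi> (z + s *\<^sub>R w) + \<phi> z - s\<^sup>2 * (h v \<bullet> w)\<bar>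
      \<le> 2 * \<epsilon> * N\<^sup>2 * s\<^sup>2" if s: "0 < s" "s < d" for s
  proof -
    have small: "norm (b *\<^sub>R v + a *\<^sub>R w) \<le> s * N" "norm (b *\<^sub>R v + a *\<^sub>R w) < min d1 d2"
      if "0 \<le> a" "a \<le> s" "0 \<le> b" "b \<le> s" for a b
    proof -
      have "norm (b *\<^sub>R v + a *\<^sub>R w) \<le> b * norm v + a * norm w"
        using that by (metis abs_of_nonneg norm_scaleR norm_triangle_ineq)
      also have "\<dots> \<le> s * N"
        unfolding N_def distrib_left using that by (intro add_mono mult_right_mono) auto
      finally show *: "norm (b *\<^sub>R v + a *\<^sub>R w) \<le> s * N" .
      have "s * (N + 1) < min d1 d2"
        using s N0 by (simp add: d_def pos_less_divide_eq)
      with * s show "norm (b *\<^sub>R v + a *\<^sub>R w) < min d1 d2"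
        by (simp add: algebra_simps)
    qed
    have inU: "z + (b *\<^sub>R v + a *\<^sub>R w) \<in> U" if "0 \<le> a" "a \<le> s" "0 \<le> b" "b \<le> s" for a b
      using small(2)[OF that]
      by (intro subsetD[OF d1(2)]) (metis add_diff_cancel_left' dist_commute dist_norm mem_ball min_less_iff_conj)
    \<comment> \<open>The mixed difference is \<open>F s - F 0\<close>. The term
      \<open>0 *\<^sub>R v\<close> is kept so that both slices are instances of \<open>dphi\<close>,
      with \<open>b = s\<close> and \<open>b = 0\<close>.\<close>
    define F where "F a = \<phi> (z + (s *\<^sub>R v + a *\<^sub>R w)) - \<phi> (z + (0 *\<^sub>R v + a *\<^sub>R w))" for a
    define F' where "F' a = (g (z + (s *\<^sub>R v + a *\<^sub>R w)) - g (z + (0 *\<^sub>R v + a *\<^sub>R w))) \<bullet> w" for a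
    have dphi: "((\<lambda>a. \<phi> (z + (b *\<^sub>R v + a *\<^sub>R w))) has_real_derivative
        g (z + (b *\<^sub>R v + a *\<^sub>R w)) \<bullet> w) (at a)"
      if "0 \<le> a" "a \<le> s" "0 \<le> b" "b \<le> s" for a b
    proof -
      have "((\<lambda>a. z + (b *\<^sub>R v + a *\<^sub>R w)) has_derivative (\<lambda>t. t *\<^sub>R w)) (at a)"
        by (auto intro!: derivative_eq_intros)
      from has_derivative_compose[OF this D[OF inU[OF that], unfolded gderiv_def]]
      show ?thesis
        by (simp add: has_field_derivative_def inner_commute mult_commute_abs)
    qed
    have dF: "(F has_real_derivative F' a) (at a)" if "0 \<le> a" "a \<le> s" for a
      unfolding F_def F'_def inner_diff_left
      using that s by (intro DERIV_diff dphi) auto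
    obtain a where a: "0 < a" "a < s" "F s - F 0 = (s - 0) * F' a"
      using MVT2[of 0 s F F'] dF s by blast
    define R where "R k = g (z + k) - g z - h k" for k
    have R: "norm (R (b *\<^sub>R v + a *\<^sub>R w)) \<le> \<epsilon> * (s * N)" if "0 \<le> b" "b \<le> s" for b
    proof -
      have "norm (R (b *\<^sub>R v + a *\<^sub>R w)) \<le> \<epsilon> * norm (b *\<^sub>R v + a *\<^sub>R w)"
        unfolding R_def using d2(2) small(2) a that by auto
      also have "\<dots> \<le> \<epsilon> * (s * N)"
        using small(1)[of a b] a that \<open>\<epsilon> > 0\<close> by (intro mult_left_mono) auto
      finally show ?thesis .
    qed
    \<comment> \<open>The linear parts of the two gradients share the term
      \<open>a *\<^sub>R h w\<close>, which cancels; the unknown mean value point \<open>a\<close>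
      then survives only in the remainders.\<close>
    have F'a: "F' a = s * (h v \<bullet> w) + (R (s *\<^sub>R v + a *\<^sub>R w) - R (0 *\<^sub>R v + a *\<^sub>R w)) \<bullet> w"
      unfolding F'_def R_def
      by (simp add: linear_add[OF lin] linear_scale[OF lin] inner_diff_left inner_add_left)
    have "F s - F 0 - s\<^sup>2 * (h v \<bullet> w)
      = s * ((R (s *\<^sub>R v + a *\<^sub>R w) - R (0 *\<^sub>R v + a *\<^sub>R w)) \<bullet> w)"
      unfolding a(3) F'a by (simp add: distrib_left power2_eq_square)
    moreover have "\<bar>(R (s *\<^sub>R v + a *\<^sub>R w) - R (0 *\<^sub>R v + a *\<^sub>R w)) \<bullet> w\<bar>
      \<le> (\<epsilon> * (s * N) + \<epsilon> * (s * N)) * N"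
    proof -
      have "norm (R (s *\<^sub>R v + a *\<^sub>R w) - R (0 *\<^sub>R v + a *\<^sub>R w)) \<le> \<epsilon> * (s * N) + \<epsilon> * (s * N)"
        using s by (intro order_trans[OF norm_triangle_ineq4] add_mono R) auto
      moreover have "norm w \<le> N"
        by (simp add: N_def)
      ultimately show ?thesis
        by (meson Cauchy_Schwarz_ineq2 mult_mono norm_ge_zero order_trans)
    qed
    ultimately have "\<bar>F s - F 0 - s\<^sup>2 * (h v \<bullet> w)\<bar> \<le> s * ((\<epsilon> * (s * N) + \<epsilon> * (s * N)) * N)"
      using s by (simp add: abs_mult)
    then show ?thesis
      by (simp add: F_def algebra_simps power2_eq_square)
  qed
  then show ?thesis
    unfolding eventually_at_right_field N_def[symmetric] using \<open>d > 0\<close> by auto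
qed

text \<open>The mixed difference is unchanged when \<open>v\<close> and \<open>w\<close> are
  exchanged, yet it approximates \<open>s\<^sup>2 * (h v \<bullet> w)\<close> as well as
  \<open>s\<^sup>2 * (h w \<bullet> v)\<close>. Dividing by \<open>s\<^sup>2\<close> leaves an error
  of order \<epsilon>. The result places Hessians of test functions in
  \<open>sym_matrices\<close>.\<close>

lemma second_derivative_symmetric:
  fixes \<phi> :: "'a::euclidean_space \<Rightarrow> real"
  assumes "open U" "z \<in> U" and "\<And>w. w \<in> U \<Longrightarrow> GDERIV \<phi> w :> g w"
    and "(g has_derivative h) (at z)"
  shows "h v \<bullet> w = h w \<bullet> v"
proof -
  have *: "\<bar>h v \<bullet> w - h w \<bullet> v\<bar> \<le> \<epsilon> * (4 * (norm v + norm w)\<^sup>2)" if "\<epsilon> > 0" for \<epsilon>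
  proof -
    note bound = mixed_difference_bound[where \<phi> = \<phi> and g = g, OF assms \<open>\<epsilon> > 0\<close>, simplified]
    have "\<forall>\<^sub>F s in at_right 0.
      \<bar>\<phi> (z + s *\<^sub>R v + s *\<^sub>R w) - \<phi> (z + s *\<^sub>R v) - \<phi> (z + s *\<^sub>R w) + \<phi> z - s\<^sup>2 * (h v \<bullet> w)\<bar>
        \<le> 2 * \<epsilon> * (norm v + norm w)\<^sup>2 * s\<^sup>2 \<and>
      \<bar>\<phi> (z + s *\<^sub>R w + s *\<^sub>R v) - \<phi> (z + s *\<^sub>R w) - \<phi> (z + s *\<^sub>R v) + \<phi> z - s\<^sup>2 * (h w \<bullet> v)\<bar>
        \<le> 2 * \<epsilon> * (norm w + norm v)\<^sup>2 * s\<^sup>2 \<and> 0 < s"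
      by (intro eventually_conj bound eventually_at_right_less)
    then obtain s where elim:
      "\<bar>\<phi> (z + s *\<^sub>R v + s *\<^sub>R w) - \<phi> (z + s *\<^sub>R v) - \<phi> (z + s *\<^sub>R w) + \<phi> z - s\<^sup>2 * (h v \<bullet> w)\<bar>
        \<le> 2 * \<epsilon> * (norm v + norm w)\<^sup>2 * s\<^sup>2"
      "\<bar>\<phi> (z + s *\<^sub>R w + s *\<^sub>R v) - \<phi> (z + s *\<^sub>R w) - \<phi> (z + s *\<^sub>R v) + \<phi> z - s\<^sup>2 * (h w \<bullet> v)\<bar>
        \<le> 2 * \<epsilon> * (norm w + norm v)\<^sup>2 * s\<^sup>2" "0 < s"
      by (metis (no_types, lifting) eventually_happens' trivial_limit_at_right_real)
    define m where "m = \<phi> (z + s *\<^sub>R v + s *\<^sub>R w) - \<phi> (z + s *\<^sub>R v) - \<phi> (z + s *\<^sub>R w) + \<phi> z"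
    have "\<bar>m - s\<^sup>2 * (h v \<bullet> w)\<bar> \<le> 2 * \<epsilon> * (norm v + norm w)\<^sup>2 * s\<^sup>2"
      using elim(1) by (simp add: m_def)
    moreover have "m = \<phi> (z + s *\<^sub>R w + s *\<^sub>R v) - \<phi> (z + s *\<^sub>R w) - \<phi> (z + s *\<^sub>R v) + \<phi> z"
      by (simp add: m_def add.assoc add.commute add.left_commute)
    then have "\<bar>m - s\<^sup>2 * (h w \<bullet> v)\<bar> \<le> 2 * \<epsilon> * (norm v + norm w)\<^sup>2 * s\<^sup>2"
      using elim(2) by (simp add: add.commute)
    ultimately have "\<bar>s\<^sup>2 * (h v \<bullet> w) - s\<^sup>2 * (h w \<bullet> v)\<bar> \<le> 4 * \<epsilon> * (norm v + norm w)\<^sup>2 * s\<^sup>2"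
      by linarith
    then have "s\<^sup>2 * \<bar>h v \<bullet> w - h w \<bullet> v\<bar> \<le> s\<^sup>2 * (\<epsilon> * (4 * (norm v + norm w)\<^sup>2))"
      by (simp add: abs_mult mult_ac flip: right_diff_distrib left_diff_distrib)
    then show ?thesis
      using elim(3) by (simp add: mult_le_cancel_left_pos)
  qed
  \<comment> \<open>Here \<epsilon> is \<open>e\<close> divided by the constant in \<open>*\<close>
    plus 1, since that constant vanishes for \<open>v = w = 0\<close>.\<close>
  have "\<bar>h v \<bullet> w - h w \<bullet> v\<bar> \<le> 0 + e" if "e > 0" for e
  proof -
    have "\<bar>h v \<bullet> w - h w \<bullet> v\<bar> \<le> (e / (4 * (norm v + norm w)\<^sup>2 + 1)) * (4 * (norm v + norm w)\<^sup>2)"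
      using *[of "e / (4 * (norm v + norm w)\<^sup>2 + 1)"] that by (simp add: add_nonneg_pos)
    also have "\<dots> \<le> e"
      using that by (simp add: divide_le_eq add_nonneg_pos distrib_left)
    finally show ?thesis by simp
  qed
  then have "\<bar>h v \<bullet> w - h w \<bullet> v\<bar> \<le> 0"
    by (rule field_le_epsilon)
  then show ?thesis
    by simp
qed

section \<open>A modulus of continuity above an infinitesimal function\<close>

text \<open>The assumption on \<open>boundary_gap\<close> speaks of continuous, monotone moduli,
  whereas the penalization yields only some bound tending to 0 at the right of 0. This converts the
  latter into the former.\<close>

lemma modulus_of_continuity_above:
  fixes \<theta> :: "real \<Rightarrow> real"
  assumes "(\<theta> \<longlongrightarrow> 0) (at_right 0)"
  shows "\<exists>\<omega>. modulus_of_continuity \<omega> \<and> (\<forall>\<^sub>F s in at_right 0. \<theta> s \<le> \<omega> s)"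
proof -
  have small: "\<exists>\<rho>>0. \<forall>s. 0 < s \<and> s < \<rho> \<longrightarrow> \<theta> s < a" if "a > 0" for a
    using order_tendstoD(2)[OF assms that] unfolding eventually_at_right_field by auto
  obtain r where r: "r > 0" "\<And>s. 0 < s \<Longrightarrow> s < r \<Longrightarrow> \<theta> s < 1"
    using small[of 1] by auto
  txt \<open>The lower envelope of the affine majorants of \<open>\<theta>\<close> is concave, hence continuous.\<close>
  define A where "A = {(a, b). a \<ge> 0 \<and> b \<ge> 0 \<and> (\<forall>s. 0 < s \<and> s < r \<longrightarrow> \<theta> s \<le> a + b * s)}"
  define \<omega> where "\<omega> s = (INF (a, b)\<in>A. a + b * s)" for s
  have slope: "\<exists>b. (a, b) \<in> A" if "a > 0" for a
  proof -
    obtain \<rho> where \<rho>: "\<rho> > 0" "\<And>s. 0 < s \<Longrightarrow> s < \<rho> \<Longrightarrow> \<theta> s < a"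
      using small[OF \<open>a > 0\<close>] by auto
    \<comment> \<open>Before \<rho> the intercept alone dominates \<theta>; from \<rho> on the
      linear term is at least 1, which dominates \<theta> on the whole interval up to
      \<open>r\<close>.\<close>
    have "\<theta> s \<le> a + 1 / \<rho> * s" if s: "0 < s" "s < r" for s
    proof (cases "s < \<rho>")
      case True
      have "0 \<le> 1 / \<rho> * s" using \<rho> s by simp
      with \<rho>(2)[OF s(1) True] show ?thesis by linarith
    next
      case False
      then have "1 \<le> 1 / \<rho> * s" using \<rho> by (simp add: field_simps)
      with r(2)[OF s] \<open>a > 0\<close> show ?thesis by linarith
    qed
    then have "(a, 1 / \<rho>) \<in> A"
      using \<rho> that by (auto simp: A_def)
    then show ?thesis by blast
  qed
  have ne: "A \<noteq> {}"
    using slope[of 1] by auto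
  have lower: "\<omega> s \<le> a + b * s" if "(a, b) \<in> A" "s \<ge> 0" for a b s
    unfolding \<omega>_def
    by (rule cINF_lower2[OF _ that(1)]) (use that in \<open>auto simp: A_def bdd_below_def intro!: exI[of _ 0]\<close>)
  have greatest: "m \<le> \<omega> s" if "\<And>a b. (a, b) \<in> A \<Longrightarrow> m \<le> a + b * s" for m s
    unfolding \<omega>_def by (rule cINF_greatest[OF ne]) (use that in auto)
  have nonneg: "0 \<le> \<omega> s" if "s \<ge> 0" for s
    by (rule greatest) (use that in \<open>auto simp: A_def\<close>)
  have mono: "\<omega> s \<le> \<omega> t" if "0 \<le> s" "s \<le> t" for s t
  proof (rule greatest)
    fix a b assume ab: "(a, b) \<in> A"
    then have "b * s \<le> b * t"
      using that by (auto simp: A_def intro: mult_left_mono)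
    with lower[OF ab that(1)] show "\<omega> s \<le> a + b * t" by linarith
  qed
  have zero: "\<omega> 0 = 0"
  proof -
    have "\<omega> 0 \<le> 0 + a" if "a > 0" for a
      using slope[OF that] lower[of a _ 0] by auto
    then have "\<omega> 0 \<le> 0" by (rule field_le_epsilon)
    with nonneg[of 0] show ?thesis by simp
  qed
  have conv: "convex_on {0<..} (\<lambda>s. - \<omega> s)"
  proof (rule convex_onI)
    fix t x y :: real
    assume t: "0 < t" "t < 1" and xy: "x \<in> {0<..}" "y \<in> {0<..}"
    have "(1 - t) * \<omega> x + t * \<omega> y \<le> \<omega> ((1 - t) * x + t * y)"
    proof (rule greatest)
      fix a b assume ab: "(a, b) \<in> A"
      have "(1 - t) * \<omega> x + t * \<omega> y \<le> (1 - t) * (a + b * x) + t * (a + b * y)"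
        using t xy lower[OF ab] by (intro add_mono mult_left_mono) auto
      then show "(1 - t) * \<omega> x + t * \<omega> y \<le> a + b * ((1 - t) * x + t * y)"
        by (simp add: algebra_simps)
    qed
    then show "- \<omega> ((1 - t) *\<^sub>R x + t *\<^sub>R y) \<le> (1 - t) * - \<omega> x + t * - \<omega> y"
      by simp
  qed auto
  have "continuous_on {0<..} (\<lambda>s. - (- \<omega> s))"
    by (intro continuous_on_minus convex_on_continuous[OF _ conv]) auto
  then have pos: "isCont \<omega> s" if "s > 0" for s
    using that by (simp add: continuous_on_eq_continuous_at)
  \<comment> \<open>Concavity gives continuity only on the open half-line. At 0 a single majorant
    with intercept \<open>e / 2\<close> suffices.\<close>
  have "continuous (at 0 within {0..}) \<omega>"
    unfolding continuous_within zero
  proof (rule tendstoI)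
    fix e :: real assume "e > 0"
    then obtain b where b: "(e / 2, b) \<in> A"
      using slope[of "e / 2"] by auto
    then have b0: "b \<ge> 0" by (auto simp: A_def)
    have "\<omega> s < e" if "0 \<le> s" "s < e / (2 * (b + 1))" for s
    proof -
      have "b * s \<le> (b + 1) * s" using that by (simp add: algebra_simps)
      also have "\<dots> < e / 2"
        using that b0 by (simp add: field_simps)
      finally show ?thesis
        using lower[OF b that(1)] by linarith
    qed
    then show "\<forall>\<^sub>F s in at 0 within {0..}. dist (\<omega> s) 0 < e"
      unfolding eventually_at using \<open>e > 0\<close> b0 nonneg
      by (intro exI[of _ "e / (2 * (b + 1))"]) (auto simp: dist_norm)
  qed
  then have "continuous_on {0..} \<omega>"
    unfolding continuous_on_eq_continuous_within
    using pos by (metis atLeast_iff continuous_at_imp_continuous_at_within order_le_less)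
  moreover have "mono_on {0..} \<omega>"
    by (intro mono_onI mono) auto
  ultimately have "modulus_of_continuity \<omega>"
    using nonneg zero by (simp add: modulus_of_continuity_def)
  moreover have "\<theta> s \<le> \<omega> s" if "0 < s" "s < r" for s
    by (rule greatest) (use that in \<open>auto simp: A_def\<close>)
  then have "\<forall>\<^sub>F s in at_right 0. \<theta> s \<le> \<omega> s"
    unfolding eventually_at_right_field using r(1) by auto
  ultimately show ?thesis by blast
qed

section \<open>Time derivatives up to the lateral boundary\<close>

text \<open>For interior \<open>y\<close> near \<open>x\<close>, the function
  \<open>\<phi> (y, \<tau>) - a * \<tau>\<close> has a small \<tau>-derivative, so the mean value
  inequality gives the difference quotient estimate with a constant independent of \<open>y\<close>.
  By continuity of \<phi> it survives the limit \<open>y\<close> to \<open>x\<close>.\<close>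

lemma time_derivative_up_to_boundary:
  fixes \<phi> :: "(real ^ 'n) \<times> real \<Rightarrow> real"
  assumes \<phi>: "continuous_on (closure \<Omega> \<times> {0<..<T}) \<phi>"
    and g: "continuous_on (closure \<Omega> \<times> {0<..<T}) g"
    and D: "\<And>z. z \<in> \<Omega> \<times> {0<..<T} \<Longrightarrow> GDERIV \<phi> z :> g z"
    and x: "x \<in> closure \<Omega>" and t: "t \<in> {0<..<T}"
  shows "((\<lambda>s. \<phi> (x, s)) has_real_derivative snd (g (x, t))) (at t)"
  unfolding has_field_derivative_def has_derivative_at_alt
proof (intro conjI allI impI)
  fix e :: real assume "e > 0"
  define a where "a = snd (g (x, t))"
  obtain d where d: "d > 0"
    "\<And>z. z \<in> closure \<Omega> \<times> {0<..<T} \<Longrightarrow> dist z (x, t) < d \<Longrightarrow> dist (g z) (g (x, t)) < e"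
    using g \<open>e > 0\<close> x t unfolding continuous_on_iff by (metis SigmaI)
  \<comment> \<open>One half of \<open>d\<close> is reserved for the time displacement and the other
    for the space displacement; the remaining terms keep the times in the open interval.\<close>
  define d' where "d' = min (d / 2) (min t (T - t))"
  have "d' > 0"
    using d t by (simp add: d'_def)
  have sub: "s \<in> {0<..<T}" "\<bar>s - t\<bar> < d / 2" if "s \<in> ball t d'" for s
    using that by (auto simp: d'_def dist_real_def abs_minus_commute)
  have interior: "\<bar>\<phi> (y, s) - \<phi> (y, t) - a * (s - t)\<bar> \<le> e * \<bar>s - t\<bar>"
    if y: "y \<in> \<Omega>" "dist y x < d / 2" and s: "s \<in> ball t d'" for y s
  proof -
    define m where "m \<tau> = \<phi> (y, \<tau>) - a * \<tau>" for \<tau>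
    have "norm (m s - m t) \<le> e * norm (s - t)"
    proof (rule field_differentiable_bound[of "ball t d'" m "\<lambda>\<tau>. snd (g (y, \<tau>)) - a"])
      fix \<tau> assume \<tau>: "\<tau> \<in> ball t d'"
      have yt: "(y, \<tau>) \<in> \<Omega> \<times> {0<..<T}"
        using y sub[OF \<tau>] by simp
      have "((\<lambda>\<tau>. (y, \<tau>)) has_derivative (\<lambda>h. (0, h))) (at \<tau>)"
        by (auto intro!: derivative_eq_intros)
      from has_derivative_compose[OF this D[OF yt, unfolded gderiv_def]]
      have "((\<lambda>\<tau>. \<phi> (y, \<tau>)) has_real_derivative snd (g (y, \<tau>))) (at \<tau>)"
        by (simp add: has_field_derivative_def inner_prod_def mult.commute mult_commute_abs)
      then have "(m has_real_derivative snd (g (y, \<tau>)) - a) (at \<tau>)"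
        unfolding m_def by (auto intro!: derivative_eq_intros)
      then show "(m has_real_derivative snd (g (y, \<tau>)) - a) (at \<tau> within ball t d')"
        by (rule has_field_derivative_at_within)
      have "dist (y, \<tau>) (x, t) \<le> dist y x + dist \<tau> t"
        unfolding dist_prod_def by (simp add: sqrt_sum_squares_le_sum)
      also have "\<dots> < d"
        using y sub[OF \<tau>] by (simp add: dist_real_def)
      finally have "dist (g (y, \<tau>)) (g (x, t)) < e"
        using y sub[OF \<tau>] closure_subset by (intro d(2)) auto
      then have "dist (snd (g (y, \<tau>))) (snd (g (x, t))) < e"
        using dist_snd_le le_less_trans by blast
      then show "norm (snd (g (y, \<tau>)) - a) \<le> e"
        by (simp add: a_def dist_norm)
    qed (use s \<open>d' > 0\<close> in auto)
    then show ?thesis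
      by (simp add: m_def algebra_simps)
  qed
  have "\<bar>\<phi> (x, s) - \<phi> (x, t) - a * (s - t)\<bar> \<le> e * \<bar>s - t\<bar>" if s: "s \<in> ball t d'" for s
  proof -
    obtain X where X: "\<And>k. X k \<in> \<Omega>" "X \<longlonglongrightarrow> x"
      using x closure_sequential by metis
    have lim: "(\<lambda>k. \<phi> (X k, \<tau>)) \<longlonglongrightarrow> \<phi> (x, \<tau>)" if "\<tau> \<in> {0<..<T}" for \<tau>
      by (rule continuous_on_tendsto_compose[OF \<phi>])
        (use X x that closure_subset[of \<Omega>] in \<open>auto intro!: tendsto_intros always_eventually dest: subsetD\<close>)
    have "\<forall>\<^sub>F k in sequentially. dist (X k) x < d / 2"
      using X(2) d(1) by (intro tendstoD) auto
    then have "\<forall>\<^sub>F k in sequentially. \<bar>\<phi> (X k, s) - \<phi> (X k, t) - a * (s - t)\<bar> \<le> e * \<bar>s - t\<bar>"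
      by (rule eventually_mono) (use X(1) s interior in blast)
    moreover have "(\<lambda>k. \<bar>\<phi> (X k, s) - \<phi> (X k, t) - a * (s - t)\<bar>)
        \<longlonglongrightarrow> \<bar>\<phi> (x, s) - \<phi> (x, t) - a * (s - t)\<bar>"
      using sub(1)[OF s] t by (intro tendsto_intros lim)
    ultimately show ?thesis
      by (intro tendsto_upperbound[where F = sequentially]) auto
  qed
  then show "\<exists>d>0. \<forall>s. norm (s - t) < d \<longrightarrow>
      norm (\<phi> (x, s) - \<phi> (x, t) - snd (g (x, t)) * (s - t)) \<le> e * norm (s - t)"
    using \<open>d' > 0\<close> by (intro exI[of _ d']) (auto simp: a_def dist_real_def abs_minus_commute)
qed (rule bounded_linear_mult_right)

section \<open>Slice derivatives of test functions and the quadratic penalty\<close>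

lemma inner_axis_fst: "a \<bullet> (axis i 1, 0) = fst a $ i" "(axis i 1, 0) \<bullet> a = fst a $ i"
  for a :: "(real ^ 'n) \<times> real"
  by (simp_all add: inner_prod_def inner_axis inner_axis')

text \<open>The chain rule along coordinate lines. It links the derivatives in the viscosity
  inequalities, which are coordinatewise uses of \<open>deriv\<close>, to the space-time gradient
  \<open>g\<close> and its derivative \<open>h\<close>, for which sums and negatives are easy to
  handle.\<close>

lemma slice_derivatives:
  fixes \<phi> :: "(real ^ 'n) \<times> real \<Rightarrow> real"
  assumes "open \<Omega>" and D: "\<And>z. z \<in> \<Omega> \<times> {0<..<T} \<Longrightarrow> GDERIV \<phi> z :> g z"
    and x: "x \<in> \<Omega>" and t: "t \<in> {0<..<T}"
  shows time_deriv_eq: "time_deriv \<phi> x t = snd (g (x, t))"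
    and space_grad_eq: "space_grad \<phi> x t = fst (g (x, t))"
    and space_hess_eq: "(g has_derivative h) (at (x, t)) \<Longrightarrow>
      space_hess \<phi> x t = (\<chi> i j. fst (h (axis j 1, 0)) $ i)"
proof -
  have "((\<lambda>\<tau>. (x, \<tau>)) has_derivative (\<lambda>h. (0, h))) (at t)"
    by (auto intro!: derivative_eq_intros)
  from has_derivative_compose[OF this D[unfolded gderiv_def]] x t
  have "((\<lambda>\<tau>. \<phi> (x, \<tau>)) has_real_derivative snd (g (x, t))) (at t)"
    by (simp add: has_field_derivative_def inner_prod_def mult_commute_abs)
  then show "time_deriv \<phi> x t = snd (g (x, t))"
    unfolding time_deriv_def by (rule DERIV_imp_deriv)
  have line: "((\<lambda>a. (y + a *\<^sub>R axis i 1, t)) has_derivative (\<lambda>b. b *\<^sub>R (axis i 1, 0))) (at a)"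
    for y :: "real ^ 'n" and i a
    by (auto intro!: derivative_eq_intros)
  have grad: "space_grad \<phi> y t = fst (g (y, t))" if "y \<in> \<Omega>" for y
  proof -
    have "((\<lambda>a. \<phi> (y + a *\<^sub>R axis i 1, t)) has_real_derivative fst (g (y, t)) $ i) (at 0)" for i
    proof -
      have "(\<phi> has_derivative (\<lambda>k. k \<bullet> g (y, t))) (at (y + 0 *\<^sub>R axis i 1, t))"
        using D[of "(y, t)"] that t by (simp add: gderiv_def)
      from has_derivative_compose[OF line this] show ?thesis
        by (simp add: has_field_derivative_def inner_axis_fst mult_commute_abs del: scaleR_Pair)
    qed
    then show ?thesis
      by (simp add: space_grad_def vec_eq_iff DERIV_imp_deriv)
  qed
  then show "space_grad \<phi> x t = fst (g (x, t))"
    using x .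
  assume h: "(g has_derivative h) (at (x, t))"
  have "deriv (\<lambda>a. space_grad \<phi> (x + a *\<^sub>R axis j 1) t $ i) 0 = fst (h (axis j 1, 0)) $ i" for i j
  proof -
    have "((\<lambda>a. g (x + a *\<^sub>R axis j 1, t)) has_derivative (\<lambda>b. h (b *\<^sub>R (axis j 1, 0)))) (at 0)"
      using has_derivative_compose[OF line[of x j 0], where g = g] h by simp
    then have "((\<lambda>a. fst (g (x + a *\<^sub>R axis j 1, t)) $ i) has_derivative
        (\<lambda>b. fst (h (b *\<^sub>R (axis j 1, 0))) $ i)) (at 0)"
      by (intro bounded_linear.has_derivative[OF bounded_linear_vec_nth] has_derivative_fst)
    moreover have "h (b *\<^sub>R (axis j 1, 0)) = b *\<^sub>R h (axis j 1, 0)" for b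
      using h linear_scale has_derivative_linear by blast
    ultimately have "((\<lambda>a. fst (g (x + a *\<^sub>R axis j 1, t)) $ i) has_real_derivative
        fst (h (axis j 1, 0)) $ i) (at 0)"
      by (simp add: has_field_derivative_def mult_commute_abs del: scaleR_Pair)
    \<comment> \<open>The formula for \<open>space_grad\<close> is available only inside \<Omega>,
      so the two functions of \<open>a\<close> are compared only near 0; this is enough for
      \<open>deriv\<close>.\<close>
    moreover have "\<forall>\<^sub>F a in nhds 0. x + a *\<^sub>R axis j 1 \<in> \<Omega>"
    proof -
      have "((\<lambda>a. x + a *\<^sub>R axis j 1) \<longlongrightarrow> x + 0 *\<^sub>R axis j 1) (nhds (0::real))"
        by (intro tendsto_intros filterlim_ident)
      then show ?thesis
        using topological_tendstoD \<open>open \<Omega>\<close> x by fastforce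
    qed
    then have "\<forall>\<^sub>F a in nhds 0. space_grad \<phi> (x + a *\<^sub>R axis j 1) t $ i
        = fst (g (x + a *\<^sub>R axis j 1, t)) $ i"
      by (rule eventually_mono) (simp add: grad)
    ultimately show ?thesis
      by (subst deriv_cong_ev) (auto intro: DERIV_imp_deriv)
  qed
  then show "space_hess \<phi> x t = (\<chi> i j. fst (h (axis j 1, 0)) $ i)"
    by (simp add: space_hess_def vec_eq_iff)
qed

lemma GDERIV_quadratic:
  fixes b :: "'a::real_inner"
  shows "GDERIV (\<lambda>w. (snd w - t0)\<^sup>2 + \<kappa> * ((fst w - b) \<bullet> (fst w - b))) z :>
    ((2 * \<kappa>) *\<^sub>R (fst z - b), 2 * (snd z - t0))"
proof -
  have "((\<lambda>w. (snd w - t0)\<^sup>2 + \<kappa> * ((fst w - b) \<bullet> (fst w - b))) has_derivative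
    (\<lambda>k. 2 * (snd z - t0) * snd k + \<kappa> * ((fst z - b) \<bullet> fst k + fst k \<bullet> (fst z - b)))) (at z)"
    by (auto intro!: derivative_eq_intros simp: fun_eq_iff)
  moreover have "(\<lambda>k. 2 * (snd z - t0) * snd k + \<kappa> * ((fst z - b) \<bullet> fst k + fst k \<bullet> (fst z - b)))
    = (\<lambda>k. k \<bullet> ((2 * \<kappa>) *\<^sub>R (fst z - b), 2 * (snd z - t0)))"
    by (simp add: fun_eq_iff inner_prod_def inner_commute[of "fst z - b"])
  ultimately show ?thesis
    unfolding gderiv_def by simp
qed

lemma C2_up_to_minus:
  assumes "C2_up_to U K \<phi>"
  shows "C2_up_to U K (\<lambda>z. - \<phi> z)"
proof -
  obtain g h where "continuous_on K \<phi>" "continuous_on K g" "\<And>v. continuous_on K (\<lambda>z. h z v)"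
    "\<And>z. z \<in> U \<Longrightarrow> GDERIV \<phi> z :> g z" "\<And>z. z \<in> U \<Longrightarrow> (g has_derivative h z) (at z)"
    using assms unfolding C2_up_to_def by blast
  then show ?thesis
    unfolding C2_up_to_def
    by (intro conjI exI[of _ "\<lambda>z. - g z"] exI[of _ "\<lambda>z v. - h z v"] allI ballI
        continuous_on_minus GDERIV_minus has_derivative_minus) auto
qed

section \<open>The boundary inequality at a local maximum\<close>

text \<open>The subsolution property enters as a bare test inequality for a function continuous up
  to the lateral boundary, a form that fits both the extended solution and, after reflection, its
  negative.\<close>

lemma boundary_inequality_subsolution:
  fixes \<Omega> :: "(real ^ 'n) set"
  assumes "open \<Omega>" and cone: "interior_cone_property \<Omega>"
    and G: "continuous_on (frontier \<Omega> \<times> UNIV) (\<lambda>(y, r). G y r)"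
    and gap: "\<And>\<omega>. modulus_of_continuity \<omega> \<Longrightarrow> (boundary_gap \<Omega> H G \<omega> \<longlongrightarrow> 0) (at_right 0)"
    and sub: "\<And>\<psi> y s. C2_on (\<Omega> \<times> {0<..<T}) \<psi> \<Longrightarrow>
        local_max_on (\<Omega> \<times> {0<..<T}) (\<lambda>z. u z - \<psi> z) (y, s) \<Longrightarrow>
        time_deriv \<psi> y s + H y (u (y, s)) (space_grad \<psi> y s) (space_hess \<psi> y s) \<le> 0"
    and u: "continuous_on (closure \<Omega> \<times> {0<..<T}) u"
    and \<phi>: "C2_up_to (\<Omega> \<times> {0<..<T}) (closure \<Omega> \<times> {0<..<T}) \<phi>"
    and x0: "x0 \<in> frontier \<Omega>" and t0: "t0 \<in> {0<..<T}"
    and max: "local_max_on (closure \<Omega> \<times> {0<..<T}) (\<lambda>z. u z - \<phi> z) (x0, t0)"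
  shows "time_deriv \<phi> x0 t0 + G x0 (u (x0, t0)) \<le> 0"
proof (rule ccontr)
  define U where "U = \<Omega> \<times> {0<..<T}"
  define K where "K = closure \<Omega> \<times> {0<..<T}"
  define z0 where "z0 = (x0, t0)"
  have "open U"
    unfolding U_def using \<open>open \<Omega>\<close> by (intro open_Times) auto
  have "U \<subseteq> K"
    unfolding U_def K_def using closure_subset by auto
  have x0cl: "x0 \<in> closure \<Omega>"
    using x0 by (simp add: frontier_def)
  have z0: "z0 \<in> K"
    using x0cl t0 by (simp add: z0_def K_def)
  note u = u[folded K_def]
  obtain g h where \<phi>c: "continuous_on K \<phi>" and g: "continuous_on K g"
    and h: "\<And>v. continuous_on K (\<lambda>z. h z v)"
    and D: "\<And>z. z \<in> U \<Longrightarrow> GDERIV \<phi> z :> g z"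
    and D2: "\<And>z. z \<in> U \<Longrightarrow> (g has_derivative h z) (at z)"
    using \<phi> unfolding C2_up_to_def U_def[symmetric] K_def[symmetric] by blast
  define Hess where "Hess z = ((\<chi> i j. fst (h z (axis j 1, 0)) $ i) :: real ^ 'n ^ 'n)" for z
  have Hess: "continuous_on K Hess"
    unfolding Hess_def by (intro continuous_intros h)
  have td: "time_deriv \<phi> x0 t0 = snd (g z0)"
    unfolding time_deriv_def z0_def
    by (intro DERIV_imp_deriv time_derivative_up_to_boundary[OF _ _ _ x0cl t0])
      (use \<phi>c g D in \<open>auto simp: K_def U_def\<close>)
  assume "\<not> time_deriv \<phi> x0 t0 + G x0 (u (x0, t0)) \<le> 0"
  \<comment> \<open>The amount by which the claim is supposed to fail. One half of \<open>L\<close>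
    is spent on moving from \<open>z0\<close> to nearby points, the other half on replacing
    \<open>H\<close> by \<open>G\<close>.\<close>
  define L where "L = snd (g z0) + G x0 (u z0)"
  have "L > 0"
    using \<open>\<not> _\<close> by (simp add: L_def td z0_def)

  have G0: "continuous_on UNIV (G x0)"
  proof -
    have "continuous_on UNIV (\<lambda>r::real. (x0, r))"
      by (intro continuous_intros)
    from continuous_on_compose2[OF G this] x0 show ?thesis
      by auto
  qed
  \<comment> \<open>The boundary expression for the penalized test function: the middle term is the
    time derivative of \<open>(t - t0)\<^sup>2\<close>, and the space variable of \<open>G\<close>
    is frozen at \<open>x0\<close>.\<close>
  define P where "P z = snd (g z) + 2 * (snd z - t0) + G x0 (u z)" for z
  have P: "continuous_on K P"
    unfolding P_def
    by (intro continuous_intros continuous_on_compose2[OF G0] g u) auto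
  obtain \<eta> where "\<eta> > 0" and max\<eta>: "\<And>z. z \<in> K \<Longrightarrow> dist z z0 < \<eta> \<Longrightarrow> u z - \<phi> z \<le> u z0 - \<phi> z0"
    and P\<eta>: "\<And>z. z \<in> K \<Longrightarrow> dist z z0 < \<eta> \<Longrightarrow> L / 2 < P z"
    and g\<eta>: "\<And>z. z \<in> K \<Longrightarrow> dist z z0 < \<eta> \<Longrightarrow> norm (g z) < norm (g z0) + 1"
    and H\<eta>: "\<And>z. z \<in> K \<Longrightarrow> dist z z0 < \<eta> \<Longrightarrow> norm (Hess z) < norm (Hess z0) + 1"
    and T\<eta>: "{t0 - \<eta>..t0 + \<eta>} \<subseteq> {0<..<T}"
  proof -
    have near: "\<exists>d>0. \<forall>z\<in>K. dist z z0 < d \<longrightarrow> F z < c"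
      if F: "continuous_on K F" "F z0 < c" for F :: "_ \<Rightarrow> real" and c
    proof -
      obtain d where "d > 0" "\<And>z. z \<in> K \<Longrightarrow> dist z z0 < d \<Longrightarrow> dist (F z) (F z0) < c - F z0"
        using F z0 unfolding continuous_on_iff by (metis diff_gt_0_iff_gt)
      then show ?thesis
        by (intro exI[of _ d]) (force simp: dist_real_def)
    qed
    obtain d1 where d1: "d1 > 0" "\<And>z. z \<in> K \<Longrightarrow> dist z z0 < d1 \<Longrightarrow> u z - \<phi> z \<le> u z0 - \<phi> z0"
    proof -
      from max obtain d where "d > 0" "\<forall>w\<in>K. w \<noteq> z0 \<and> dist w z0 < d \<longrightarrow> u w - \<phi> w \<le> u z0 - \<phi> z0"
        unfolding local_max_on_def eventually_at K_def z0_def by blast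
      then show ?thesis
        using that[of d] by (metis order_refl)
    qed
    have "P z0 = L"
      by (simp add: P_def L_def z0_def)
    then obtain d2 where d2: "d2 > 0" "\<forall>z\<in>K. dist z z0 < d2 \<longrightarrow> - P z < - (L / 2)"
      using near[OF continuous_on_minus[OF P], of "- (L / 2)"] \<open>L > 0\<close> by auto
    obtain d3 where d3: "d3 > 0" "\<forall>z\<in>K. dist z z0 < d3 \<longrightarrow> norm (g z) < norm (g z0) + 1"
      using near[OF continuous_on_norm[OF g], of "norm (g z0) + 1"] by auto
    obtain d4 where d4: "d4 > 0" "\<forall>z\<in>K. dist z z0 < d4 \<longrightarrow> norm (Hess z) < norm (Hess z0) + 1"
      using near[OF continuous_on_norm[OF Hess], of "norm (Hess z0) + 1"] by auto
    define d where "d = Min {d1, d2, d3, d4, t0 / 2, (T - t0) / 2}"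
    have "d > 0"
      using d1 d2 d3 d4 t0 by (simp add: d_def)
    moreover have "d \<le> d1" "d \<le> d2" "d \<le> d3" "d \<le> d4" "d \<le> t0 / 2" "d \<le> (T - t0) / 2"
      unfolding d_def by (rule Min_le; simp)+
    ultimately show ?thesis
    proof (intro that[of d])
      show "{t0 - d..t0 + d} \<subseteq> {0<..<T}"
        using \<open>d \<le> t0 / 2\<close> \<open>d \<le> (T - t0) / 2\<close> t0 by auto
      fix z assume z: "z \<in> K" "dist z z0 < d"
      show "u z - \<phi> z \<le> u z0 - \<phi> z0"
        using z \<open>d \<le> d1\<close> by (intro d1(2)) auto
      show "L / 2 < P z"
        using z \<open>d \<le> d2\<close> d2(2)[rule_format, of z] by simp
      show "norm (g z) < norm (g z0) + 1"
        using z \<open>d \<le> d3\<close> by (intro d3(2)[rule_format]) auto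
      show "norm (Hess z) < norm (Hess z0) + 1"
        using z \<open>d \<le> d4\<close> by (intro d4(2)[rule_format]) auto
    qed
  qed
  \<comment> \<open>Space and time displacements below \<open>r\<close> add up to less than
    \<eta>.\<close>
  define r where "r = \<eta> / 2"
  have "r > 0"
    using \<open>\<eta> > 0\<close> by (simp add: r_def)

  \<comment> \<open>Interior balls from the cone property and the choice of the scale\<close>
  \<comment> \<open>The cone constant is halved, so that the closed ball of radius
    \<open>c * \<delta>\<close> fits into the open ball of radius
    \<open>2 * c * \<delta>\<close>.\<close>
  obtain v c where "c > 0"
    and vc: "\<And>\<tau>. 0 < \<tau> \<Longrightarrow> \<tau> \<le> 2 * c \<Longrightarrow> ball (x0 + \<tau> *\<^sub>R v) (2 * c * \<tau>) \<subseteq> \<Omega>"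
  proof -
    define Q where "Q s \<longleftrightarrow> (\<exists>(\<nu> :: real ^ 'n \<Rightarrow> real ^ 'n) c.
        continuous_on (closure \<Omega> \<inter> ball x0 s) \<nu> \<and> c > 0 \<and>
          (\<forall>y\<in>closure \<Omega> \<inter> ball x0 s. \<forall>\<tau>. 0 < \<tau> \<and> \<tau> \<le> c \<longrightarrow>
             ball (y + \<tau> *\<^sub>R \<nu> y) (c * \<tau>) \<subseteq> \<Omega>))" for s
    have "\<forall>\<^sub>F s in at_right 0. s > 0 \<and> Q s"
      using cone x0 unfolding interior_cone_property_def Q_def
      by (intro eventually_conj eventually_at_right_less) blast
    then obtain s where "s > 0" "Q s"
      using eventually_happens'[OF trivial_limit_at_right_real] by blast
    then obtain \<nu> c where "c > 0"
      "\<And>y \<tau>. y \<in> closure \<Omega> \<inter> ball x0 s \<Longrightarrow> 0 < \<tau> \<Longrightarrow> \<tau> \<le> c \<Longrightarrow>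
        ball (y + \<tau> *\<^sub>R \<nu> y) (c * \<tau>) \<subseteq> \<Omega>"
      unfolding Q_def by blast
    moreover have "x0 \<in> closure \<Omega> \<inter> ball x0 s"
      using x0cl \<open>s > 0\<close> by simp
    ultimately show ?thesis
      using that[of "c / 2" "\<nu> x0"] by simp
  qed
  \<comment> \<open>Every point of the closed ball of radius \<open>c * \<delta>\<close> around
    \<open>a \<delta>\<close> is within \<open>C * \<delta>\<close> of \<open>x0\<close>; hence
    \<open>C * \<delta>\<close> is the distance at which the gap is evaluated.\<close>
  define C where "C = norm v + c + 1"
  have "C > 0"
    using \<open>c > 0\<close> by (simp add: C_def add_nonneg_pos)
  define a where "a \<delta> = x0 + \<delta> *\<^sub>R v" for \<delta>
  define E where "E \<delta> = \<bar>(u (a \<delta>, t0) - \<phi> (a \<delta>, t0)) - (u z0 - \<phi> z0)\<bar>" for \<delta>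
  have a\<Omega>: "cball (a \<delta>) (c * \<delta>) \<subseteq> \<Omega>" if "0 < \<delta>" "\<delta> \<le> 2 * c" for \<delta>
  proof -
    have "c * \<delta> < 2 * c * \<delta>"
      using that \<open>c > 0\<close> by simp
    then have "cball (a \<delta>) (c * \<delta>) \<subseteq> ball (a \<delta>) (2 * c * \<delta>)"
      by (meson mem_ball mem_cball order_le_less_trans subsetI)
    then show ?thesis
      using vc[OF that] by (auto simp: a_def)
  qed
  have ev_small: "\<forall>\<^sub>F \<delta> in at_right 0. 0 < \<delta> \<and> \<delta> < e" if "e > 0" for e :: real
    unfolding eventually_at_right_field using that by blast
  have E0: "(E \<longlongrightarrow> 0) (at_right 0)"
  proof -
    have "((\<lambda>\<delta>. (a \<delta>, t0)) \<longlongrightarrow> (x0 + 0 *\<^sub>R v, t0)) (at_right 0)"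
      unfolding a_def by (intro tendsto_intros)
    then have lim: "((\<lambda>\<delta>. (a \<delta>, t0)) \<longlongrightarrow> z0) (at_right 0)"
      by (simp add: z0_def)
    have "\<forall>\<^sub>F \<delta> in at_right 0. (a \<delta>, t0) \<in> K"
    proof (rule eventually_mono)
      show "\<forall>\<^sub>F \<delta> in at_right 0. 0 < \<delta> \<and> \<delta> < 2 * c"
        using \<open>c > 0\<close> by (intro ev_small) simp
      fix \<delta> assume "0 < \<delta> \<and> \<delta> < 2 * c"
      then have "a \<delta> \<in> \<Omega>"
        using \<open>c > 0\<close> by (intro subsetD[OF a\<Omega>[of \<delta>]]) auto
      then show "(a \<delta>, t0) \<in> K"
        using t0 closure_subset by (auto simp: K_def)
    qed
    then have "((\<lambda>\<delta>. u (a \<delta>, t0) - \<phi> (a \<delta>, t0)) \<longlongrightarrow> u z0 - \<phi> z0) (at_right 0)"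
      by (intro tendsto_diff continuous_on_tendsto_compose[OF u lim z0]
          continuous_on_tendsto_compose[OF \<phi>c lim z0])
    then show ?thesis
      unfolding E_def by (intro tendsto_rabs_zero) (simp add: LIM_zero)
  qed
  define Mg where "Mg = norm (g z0) + 1"
  define Mh where "Mh = norm (Hess z0) + 1"
  define m where "m = norm (mat 1 :: real ^ 'n ^ 'n)"
  \<comment> \<open>The two summands are the bounds found below for
    \<open>norm p * (C * \<delta>)\<close> and \<open>norm X * (C * \<delta>)\<^sup>2\<close>. They
    vanish in the limit because \<open>E\<close> does. A modulus above \<theta>, rescaled to
    \<open>s = C * \<delta>\<close>, makes the gradient and Hessian admissible in the gap.\<close>
  define \<theta> where "\<theta> \<delta> = C * (Mg * \<delta> + 2 * (E \<delta> + \<delta>) / c) +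
    C\<^sup>2 * (Mh * \<delta>\<^sup>2 + 2 * m * (E \<delta> + \<delta>) / c\<^sup>2)" for \<delta>
  have "((\<lambda>\<delta>. \<theta> (\<delta> / C)) \<longlongrightarrow> 0) (at_right 0)"
  proof -
    have "filterlim (\<lambda>\<delta>. \<delta> / C) (at_right 0) (at_right 0)"
      using filterlim_times_pos[OF filterlim_ident, of "1 / C" 0 0] \<open>C > 0\<close> by simp
    moreover have "(\<theta> \<longlongrightarrow> C * (Mg * 0 + 2 * (0 + 0) / c) + C\<^sup>2 * (Mh * 0\<^sup>2 + 2 * m * (0 + 0) / c\<^sup>2)) (at_right 0)"
      unfolding \<theta>_def using \<open>c > 0\<close> by (intro tendsto_intros E0) auto
    ultimately show ?thesis
      using filterlim_compose[of \<theta> "nhds 0"] by simp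
  qed
  then obtain \<omega> where \<omega>: "modulus_of_continuity \<omega>" "\<forall>\<^sub>F s in at_right 0. \<theta> (s / C) \<le> \<omega> s"
    using modulus_of_continuity_above by blast
  have scale: "filterlim (\<lambda>\<delta>. C * \<delta>) (at_right 0) (at_right 0)"
    by (rule filterlim_times_pos[OF filterlim_ident \<open>C > 0\<close>]) simp
  have "\<forall>\<^sub>F s in at_right 0. boundary_gap \<Omega> H G \<omega> s < ennreal (L / 2)"
    using gap[OF \<omega>(1)] \<open>L > 0\<close> by (intro order_tendstoD(2)) auto
  with \<omega>(2) have "\<forall>\<^sub>F s in at_right 0. \<theta> (s / C) \<le> \<omega> s \<and> boundary_gap \<Omega> H G \<omega> s < ennreal (L / 2)"
    by (rule eventually_conj)
  from filterlim_iff[THEN iffD1, OF scale, rule_format, OF this]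
  have ev1: "\<forall>\<^sub>F \<delta> in at_right 0. \<theta> \<delta> \<le> \<omega> (C * \<delta>) \<and> boundary_gap \<Omega> H G \<omega> (C * \<delta>) < ennreal (L / 2)"
    using \<open>C > 0\<close> by simp
  \<comment> \<open>This makes the time penalty exceed \<open>E \<delta>\<close> at the end times,
    where \<open>\<bar>t - t0\<bar> = r\<close>.\<close>
  have ev2: "\<forall>\<^sub>F \<delta> in at_right 0. E \<delta> < r\<^sup>2"
    using E0 \<open>r > 0\<close> by (intro order_tendstoD(2)) auto
  have "\<forall>\<^sub>F \<delta> in at_right 0. (0 < \<delta> \<and> \<delta> < min (2 * c) (r / C)) \<and> E \<delta> < r\<^sup>2 \<and>
      \<theta> \<delta> \<le> \<omega> (C * \<delta>) \<and> boundary_gap \<Omega> H G \<omega> (C * \<delta>) < ennreal (L / 2)"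
    using \<open>c > 0\<close> \<open>r > 0\<close> \<open>C > 0\<close> by (intro eventually_conj ev1 ev2 ev_small) auto
  then obtain \<delta> where \<delta>: "0 < \<delta>" "\<delta> < 2 * c" "\<delta> < r / C" "E \<delta> < r\<^sup>2" "\<theta> \<delta> \<le> \<omega> (C * \<delta>)"
    "boundary_gap \<Omega> H G \<omega> (C * \<delta>) < ennreal (L / 2)"
    using eventually_happens'[OF trivial_limit_at_right_real] by force
  have C\<delta>: "C * \<delta> < r"
    using \<delta>(3) \<open>C > 0\<close> by (simp add: field_simps)

  txt \<open>On the lateral boundary of the cylinder below the penalty \<open>q\<close> exceeds \<open>E \<delta>\<close>, whereas the
    maximum property forces \<open>q \<le> E \<delta>\<close> at the maximum point, which is therefore interior.\<close>
  define b where "b = a \<delta>"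
  \<comment> \<open>Normalized so that the space penalty equals \<open>E \<delta> + \<delta>\<close>
    on the sphere of radius \<open>c * \<delta>\<close>; the summand \<delta> makes it exceed
    \<open>E \<delta>\<close> strictly and keeps \<kappa> positive even if
    \<open>E \<delta> = 0\<close>.\<close>
  define \<kappa> where "\<kappa> = (E \<delta> + \<delta>) / (c * \<delta>)\<^sup>2"
  have E\<delta>: "E \<delta> \<ge> 0"
    by (simp add: E_def)
  have "\<kappa> > 0"
    using \<open>c > 0\<close> \<delta> E\<delta> by (simp add: \<kappa>_def)
  define q where "q z = (snd z - t0)\<^sup>2 + \<kappa> * ((fst z - b) \<bullet> (fst z - b))" for z :: "(real ^ 'n) \<times> real"
  define S where "S = cball b (c * \<delta>) \<times> cball t0 r"
  have Sx: "norm (x - x0) \<le> C * \<delta>" if "x \<in> cball b (c * \<delta>)" for x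
  proof -
    have "norm (x - x0) \<le> norm (x - b) + norm (b - x0)"
      using norm_triangle_ineq[of "x - b" "b - x0"] by simp
    also have "\<dots> \<le> c * \<delta> + \<delta> * norm v"
      using that \<delta> by (intro add_mono) (auto simp: b_def a_def dist_norm norm_minus_commute)
    also have "\<dots> \<le> C * \<delta>"
      using \<delta> by (simp add: C_def algebra_simps)
    finally show ?thesis .
  qed
  have S: "z \<in> U" "dist z z0 < \<eta>" if "z \<in> S" for z
  proof -
    have z: "fst z \<in> cball b (c * \<delta>)" "\<bar>snd z - t0\<bar> \<le> r"
      using that by (auto simp: S_def dist_real_def abs_minus_commute)
    have "snd z \<in> {t0 - \<eta>..t0 + \<eta>}"
      using z(2) \<open>\<eta> > 0\<close> unfolding r_def atLeastAtMost_iff by linarith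
    then show "z \<in> U"
      using z(1) a\<Omega>[of \<delta>] \<delta> T\<eta> by (auto simp: U_def b_def mem_Times_iff)
    have "dist z z0 \<le> dist (fst z) x0 + dist (snd z) t0"
      unfolding dist_prod_def z0_def by (simp add: sqrt_sum_squares_le_sum)
    also have "\<dots> < r + r"
      using Sx[OF z(1)] C\<delta> z(2) by (simp add: dist_norm)
    finally show "dist z z0 < \<eta>"
      by (simp add: r_def)
  qed
  have "continuous_on S (\<lambda>z. u z - \<phi> z - q z)"
    unfolding q_def
    by (intro continuous_intros continuous_on_subset[OF u] continuous_on_subset[OF \<phi>c])
      (use S(1) \<open>U \<subseteq> K\<close> in auto)
  moreover have "compact S"
    unfolding S_def by (intro compact_Times) auto
  moreover have bS: "(b, t0) \<in> S"
    using \<open>c > 0\<close> \<delta> \<open>r > 0\<close> by (simp add: S_def)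
  ultimately have "\<exists>z\<in>S. \<forall>w\<in>S. u w - \<phi> w - q w \<le> u z - \<phi> z - q z"
    by (intro continuous_attains_sup) auto
  then obtain z where z: "z \<in> S" "\<And>w. w \<in> S \<Longrightarrow> u w - \<phi> w - q w \<le> u z - \<phi> z - q z"
    by blast
  obtain x t where xt: "z = (x, t)"
    by fastforce
  have zU: "z \<in> U" and zK: "z \<in> K" and z\<eta>: "dist z z0 < \<eta>"
    using S[OF z(1)] \<open>U \<subseteq> K\<close> by auto
  have x\<Omega>: "x \<in> \<Omega>" and tT: "t \<in> {0<..<T}"
    using zU by (auto simp: xt U_def)
  have "q z \<le> E \<delta>"
  proof -
    \<comment> \<open>The competitor is the centre \<open>(b, t0)\<close>, where \<open>q\<close>
      vanishes and the loss against the maximum at \<open>z0\<close> is at most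
      \<open>E \<delta>\<close>.\<close>
    have "u z0 - \<phi> z0 - E \<delta> \<le> u (b, t0) - \<phi> (b, t0) - q (b, t0)"
    proof -
      have "q (b, t0) = 0"
        by (simp add: q_def)
      then show ?thesis
        unfolding E_def b_def by linarith
    qed
    also have "\<dots> \<le> u z - \<phi> z - q z"
      by (rule z(2)[OF bS])
    also have "\<dots> \<le> u z0 - \<phi> z0 - q z"
      using max\<eta>[OF zK z\<eta>] by simp
    finally show ?thesis by simp
  qed
  have "(t - t0)\<^sup>2 \<le> E \<delta>" and \<kappa>E: "\<kappa> * (norm (x - b))\<^sup>2 \<le> E \<delta>"
  proof -
    have "q z = (t - t0)\<^sup>2 + \<kappa> * (norm (x - b))\<^sup>2"
      by (simp add: q_def xt power2_norm_eq_inner)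
    moreover have "0 \<le> \<kappa> * (norm (x - b))\<^sup>2" "0 \<le> (t - t0)\<^sup>2"
      using \<open>\<kappa> > 0\<close> by auto
    ultimately show "(t - t0)\<^sup>2 \<le> E \<delta>" "\<kappa> * (norm (x - b))\<^sup>2 \<le> E \<delta>"
      using \<open>q z \<le> E \<delta>\<close> by linarith+
  qed
  have tr: "\<bar>t - t0\<bar> < r"
  proof (rule power2_less_imp_less)
    show "\<bar>t - t0\<bar>\<^sup>2 < r\<^sup>2"
      using \<open>(t - t0)\<^sup>2 \<le> E \<delta>\<close> \<delta>(4) by simp
  qed (use \<open>r > 0\<close> in simp)
  have xb: "norm (x - b) < c * \<delta>"
  proof (rule ccontr)
    assume "\<not> norm (x - b) < c * \<delta>"
    then have "\<kappa> * (c * \<delta>)\<^sup>2 \<le> \<kappa> * (norm (x - b))\<^sup>2"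
      using \<open>\<kappa> > 0\<close> \<open>c > 0\<close> \<delta> by (intro mult_left_mono power_mono) auto
    moreover have "\<kappa> * (c * \<delta>)\<^sup>2 = E \<delta> + \<delta>"
      using \<open>c > 0\<close> \<delta> by (simp add: \<kappa>_def)
    ultimately show False
      using \<kappa>E \<delta> by simp
  qed

  \<comment> \<open>The penalized test function and the contradiction\<close>
  define \<psi> where "\<psi> w = \<phi> w + q w" for w
  define g\<psi> where "g\<psi> w = g w + ((2 * \<kappa>) *\<^sub>R (fst w - b), 2 * (snd w - t0))" for w
  define h\<psi> where "h\<psi> w k = h w k + ((2 * \<kappa>) *\<^sub>R fst k, 2 * snd k)" for w k
  have D\<psi>: "GDERIV \<psi> w :> g\<psi> w" if "w \<in> U" for w
    unfolding \<psi>_def q_def g\<psi>_def by (intro GDERIV_add D[OF that] GDERIV_quadratic)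
  have D2\<psi>: "(g\<psi> has_derivative h\<psi> w) (at w)" if "w \<in> U" for w
    unfolding g\<psi>_def h\<psi>_def
    by (intro has_derivative_add D2[OF that]) (auto intro!: derivative_eq_intros simp: fun_eq_iff)
  have "C2_on U \<psi>"
    unfolding C2_on_def C2_up_to_def
  proof (intro conjI exI[of _ g\<psi>] exI[of _ h\<psi>] allI ballI D\<psi> D2\<psi>)
    show "continuous_on U \<psi>"
      unfolding \<psi>_def q_def
      by (intro continuous_intros continuous_on_subset[OF \<phi>c \<open>U \<subseteq> K\<close>])
    show "continuous_on U g\<psi>"
      unfolding g\<psi>_def by (intro continuous_intros continuous_on_subset[OF g \<open>U \<subseteq> K\<close>])
    show "continuous_on U (\<lambda>w. h\<psi> w k)" for k
      unfolding h\<psi>_def by (intro continuous_intros continuous_on_subset[OF h \<open>U \<subseteq> K\<close>])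
  qed
  moreover have "local_max_on U (\<lambda>w. u w - \<psi> w) (x, t)"
    unfolding local_max_on_def
  proof
    have "open (ball b (c * \<delta>) \<times> ball t0 r)"
      by (intro open_Times) auto
    moreover have "(x, t) \<in> ball b (c * \<delta>) \<times> ball t0 r"
      using xb tr by (simp add: dist_norm norm_minus_commute)
    ultimately have "\<forall>\<^sub>F w in at (x, t) within U. w \<in> ball b (c * \<delta>) \<times> ball t0 r"
      using eventually_at_topological by blast
    then show "\<forall>\<^sub>F w in at (x, t) within U. u w - \<psi> w \<le> u (x, t) - \<psi> (x, t)"
    proof (rule eventually_mono)
      fix w assume "w \<in> ball b (c * \<delta>) \<times> ball t0 r"
      then have "w \<in> S"
        by (auto simp: S_def)
      from z(2)[OF this] show "u w - \<psi> w \<le> u (x, t) - \<psi> (x, t)"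
        by (simp add: \<psi>_def xt)
    qed
  qed (use zU xt in simp)
  ultimately have visc: "time_deriv \<psi> x t + H x (u (x, t)) (space_grad \<psi> x t) (space_hess \<psi> x t) \<le> 0"
    unfolding U_def by (rule sub)
  note slice = slice_derivatives[where \<phi> = \<psi> and g = g\<psi>, OF \<open>open \<Omega>\<close> D\<psi>[unfolded U_def] x\<Omega> tT]
  define p where "p = space_grad \<psi> x t"
  define X where "X = space_hess \<psi> x t"
  have pt: "time_deriv \<psi> x t = snd (g z) + 2 * (t - t0)"
    using slice(1) by (simp add: g\<psi>_def xt)
  have p: "p = fst (g z) + (2 * \<kappa>) *\<^sub>R (x - b)"
    using slice(2) by (simp add: g\<psi>_def p_def xt)
  have X\<psi>: "X = (\<chi> i j. fst (h\<psi> z (axis j 1, 0)) $ i)"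
    using slice(3)[OF _ D2\<psi>[OF zU, unfolded xt]] by (simp add: X_def xt)
  then have X: "X = Hess z + (2 * \<kappa>) *\<^sub>R mat 1"
    by (simp add: h\<psi>_def Hess_def vec_eq_iff mat_def axis_def)
  \<comment> \<open>Required because the supremum in \<open>boundary_gap\<close> ranges over
    symmetric matrices only.\<close>
  have "X \<in> sym_matrices"
  proof -
    have "fst (h\<psi> z (axis j 1, 0)) $ i = fst (h\<psi> z (axis i 1, 0)) $ j" for i j
      using second_derivative_symmetric[where \<phi> = \<psi> and g = g\<psi>, OF \<open>open U\<close> zU D\<psi> D2\<psi>[OF zU],
          of "(axis j 1, 0)" "(axis i 1, 0)"]
      by (simp add: inner_axis_fst)
    then show ?thesis
      by (simp add: sym_matrices_def transpose_def X\<psi> vec_eq_iff)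
  qed
  \<comment> \<open>These identities say that the penalty contributes \<open>o(1) / \<delta>\<close>
    to the gradient and \<open>o(1) / \<delta>\<^sup>2\<close> to the Hessian.\<close>
  have \<kappa>c: "\<kappa> * (c * \<delta>) * \<delta> = (E \<delta> + \<delta>) / c" "\<kappa> * \<delta>\<^sup>2 = (E \<delta> + \<delta>) / c\<^sup>2"
    using \<open>c > 0\<close> \<delta> by (auto simp: \<kappa>_def power2_eq_square)
  have pos: "0 \<le> C * (Mg * \<delta> + 2 * (E \<delta> + \<delta>) / c)"
    "0 \<le> C\<^sup>2 * (Mh * \<delta>\<^sup>2 + 2 * m * (E \<delta> + \<delta>) / c\<^sup>2)"
    using \<open>c > 0\<close> \<delta> E\<delta> \<open>C > 0\<close> by (auto simp: Mg_def Mh_def m_def)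
  have "norm p * (C * \<delta>) \<le> \<omega> (C * \<delta>)"
  proof -
    have "norm p \<le> Mg + 2 * \<kappa> * (c * \<delta>)"
    proof -
      have "norm (fst (g z)) \<le> Mg"
        using g\<eta>[OF zK z\<eta>] norm_fst_le[of "fst (g z)" "snd (g z)"] by (simp add: Mg_def)
      moreover have "norm ((2 * \<kappa>) *\<^sub>R (x - b)) \<le> 2 * \<kappa> * (c * \<delta>)"
        using xb \<open>\<kappa> > 0\<close> by simp
      ultimately show ?thesis
        unfolding p by (rule norm_triangle_mono)
    qed
    then have "norm p * (C * \<delta>) \<le> (Mg + 2 * \<kappa> * (c * \<delta>)) * (C * \<delta>)"
      using \<open>C > 0\<close> \<delta> by (intro mult_right_mono) auto
    also have "\<dots> = C * (Mg * \<delta> + 2 * (\<kappa> * (c * \<delta>) * \<delta>))"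
      by (simp add: algebra_simps)
    also have "\<dots> \<le> \<theta> \<delta>"
      unfolding \<kappa>c \<theta>_def using pos(2) by simp
    finally show ?thesis
      using \<delta>(5) by linarith
  qed
  then have p_le: "norm p \<le> \<omega> (C * \<delta>) / (C * \<delta>)"
    using \<open>C > 0\<close> \<delta> by (simp add: pos_le_divide_eq)
  have "norm X * (C * \<delta>)\<^sup>2 \<le> \<omega> (C * \<delta>)"
  proof -
    have "norm X \<le> Mh + 2 * \<kappa> * m"
      unfolding X
      by (rule norm_triangle_mono) (use H\<eta>[OF zK z\<eta>] \<open>\<kappa> > 0\<close> in \<open>auto simp: Mh_def m_def\<close>)
    then have "norm X * (C * \<delta>)\<^sup>2 \<le> (Mh + 2 * \<kappa> * m) * (C * \<delta>)\<^sup>2"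
      by (intro mult_right_mono) auto
    also have "\<dots> = C\<^sup>2 * (Mh * \<delta>\<^sup>2 + 2 * m * (\<kappa> * \<delta>\<^sup>2))"
      by (simp add: algebra_simps power_mult_distrib)
    also have "\<dots> \<le> \<theta> \<delta>"
      unfolding \<kappa>c \<theta>_def using pos(1) by simp
    finally show ?thesis
      using \<delta>(5) by linarith
  qed
  then have X_le: "norm X \<le> \<omega> (C * \<delta>) / (C * \<delta>)\<^sup>2"
    using \<open>C > 0\<close> \<delta> by (simp add: pos_le_divide_eq)
  have "ennreal \<bar>H x (u z) p X - G x0 (u z)\<bar> \<le> boundary_gap \<Omega> H G \<omega> (C * \<delta>)"
    unfolding boundary_gap_def
    by (rule SUP_upper2[of "(x, x0, u z, p, X)"])
      (use x\<Omega> x0 Sx z(1) \<open>X \<in> sym_matrices\<close> p_le X_le in \<open>auto simp: S_def xt\<close>)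
  also have "\<dots> < ennreal (L / 2)"
    by (rule \<delta>(6))
  finally have "\<bar>H x (u z) p X - G x0 (u z)\<bar> < L / 2"
    using \<open>L > 0\<close> by (simp add: ennreal_less_iff)
  \<comment> \<open>Exchanging \<open>G\<close> for \<open>H\<close> costs less than
    \<open>L / 2\<close>, so the left side of the viscosity inequality stays positive.\<close>
  moreover have "L / 2 < snd (g z) + 2 * (t - t0) + G x0 (u z)"
    using P\<eta>[OF zK z\<eta>] by (simp add: P_def xt)
  moreover have "snd (g z) + 2 * (t - t0) + H x (u z) p X \<le> 0"
    using visc by (simp add: pt p_def X_def xt)
  ultimately show False
    by linarith
qed

section \<open>Reflection of test functions and of the boundary gap\<close>

text \<open>Negation passes through \<open>deriv\<close> once the derivative is known to exist; at
  points of the lateral boundary this existence comes from the limit from the interior.\<close>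

lemma time_deriv_minus_up_to_boundary:
  fixes \<phi> :: "(real ^ 'n) \<times> real \<Rightarrow> real"
  assumes "C2_up_to (\<Omega> \<times> {0<..<T}) (closure \<Omega> \<times> {0<..<T}) \<phi>"
    and x: "x \<in> closure \<Omega>" and t: "t \<in> {0<..<T}"
  shows "time_deriv (\<lambda>z. - \<phi> z) x t = - time_deriv \<phi> x t"
proof -
  obtain g where "continuous_on (closure \<Omega> \<times> {0<..<T}) \<phi>" "continuous_on (closure \<Omega> \<times> {0<..<T}) g"
    "\<And>z. z \<in> \<Omega> \<times> {0<..<T} \<Longrightarrow> GDERIV \<phi> z :> g z"
    using assms(1) unfolding C2_up_to_def by blast
  from time_derivative_up_to_boundary[OF this x t]
  have d: "((\<lambda>s. \<phi> (x, s)) has_real_derivative snd (g (x, t))) (at t)" .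
  show ?thesis
    unfolding time_deriv_def DERIV_imp_deriv[OF d] DERIV_imp_deriv[OF DERIV_minus[OF d]] ..
qed

lemma slice_derivatives_minus:
  fixes \<psi> :: "(real ^ 'n) \<times> real \<Rightarrow> real"
  assumes "open \<Omega>" "C2_on (\<Omega> \<times> {0<..<T}) \<psi>" "x \<in> \<Omega>" "t \<in> {0<..<T}"
  shows "time_deriv (\<lambda>z. - \<psi> z) x t = - time_deriv \<psi> x t"
    and "space_grad (\<lambda>z. - \<psi> z) x t = - space_grad \<psi> x t"
    and "space_hess (\<lambda>z. - \<psi> z) x t = - space_hess \<psi> x t"
proof -
  obtain g h where D: "\<And>z. z \<in> \<Omega> \<times> {0<..<T} \<Longrightarrow> GDERIV \<psi> z :> g z"
    and D2: "\<And>z. z \<in> \<Omega> \<times> {0<..<T} \<Longrightarrow> (g has_derivative h z) (at z)"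
    using assms(2) unfolding C2_on_def C2_up_to_def by blast
  have h: "(g has_derivative h (x, t)) (at (x, t))"
    using D2 assms by simp
  have m: "GDERIV (\<lambda>z. - \<psi> z) z :> - g z" if "z \<in> \<Omega> \<times> {0<..<T}" for z
    using D[OF that] by (rule GDERIV_minus)
  have mh: "((\<lambda>z. - g z) has_derivative (\<lambda>k. - h (x, t) k)) (at (x, t))"
    using h by (rule has_derivative_minus)
  note plus = slice_derivatives[where \<phi> = \<psi> and g = g, OF assms(1) D assms(3,4)]
  note minus = slice_derivatives[where \<phi> = "\<lambda>z. - \<psi> z" and g = "\<lambda>z. - g z", OF assms(1) m assms(3,4)]
  show "time_deriv (\<lambda>z. - \<psi> z) x t = - time_deriv \<psi> x t"
    "space_grad (\<lambda>z. - \<psi> z) x t = - space_grad \<psi> x t"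
    using plus(1,2) minus(1,2) by simp_all
  show "space_hess (\<lambda>z. - \<psi> z) x t = - space_hess \<psi> x t"
    using plus(3)[OF _ h] minus(3)[OF _ mh] by (simp add: vec_eq_iff)
qed

text \<open>The substitution of \<open>(- r, - p, - X)\<close> for \<open>(r, p, X)\<close>
  preserves all constraints, since only symmetry and norms enter them. One inequality suffices,
  because the reflected gap is then squeezed between 0 and a function tending to 0.\<close>

lemma boundary_gap_reflect_le:
  "boundary_gap \<Omega> (\<lambda>x r p X. - H x (- r) (- p) (- X)) (\<lambda>x r. - G x (- r)) \<omega> \<delta>
    \<le> boundary_gap \<Omega> H G \<omega> \<delta>"
proof -
  have sym: "- X \<in> sym_matrices" if "X \<in> sym_matrices" for X :: "real ^ 'a ^ 'a"
    using that by (simp add: sym_matrices_def transpose_def vec_eq_iff)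
  have "ennreal \<bar>- H x (- r) (- p) (- X) - - G y (- r)\<bar> \<le> boundary_gap \<Omega> H G \<omega> \<delta>"
    if "x \<in> \<Omega>" "y \<in> frontier \<Omega>" "norm (x - y) \<le> \<delta>" "X \<in> sym_matrices"
      "norm p \<le> \<omega> \<delta> / \<delta>" "norm X \<le> \<omega> \<delta> / \<delta>\<^sup>2" for x y r p X
    unfolding boundary_gap_def
    by (rule SUP_upper2[of "(x, y, - r, - p, - X)"])
      (use that sym in \<open>auto simp: abs_minus_commute\<close>)
  then show ?thesis
    unfolding boundary_gap_def[of _ "\<lambda>x r p X. - H x (- r) (- p) (- X)"]
    by (intro SUP_least) auto
qed

section \<open>The boundary condition at maxima and minima\<close>

theorem corollary4p3:
  fixes \<Omega> :: "(real ^ 'n) set"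
    and T :: real
    and H :: "real ^ 'n \<Rightarrow> real \<Rightarrow> real ^ 'n \<Rightarrow> real ^ 'n ^ 'n \<Rightarrow> real"
    and G :: "real ^ 'n \<Rightarrow> real \<Rightarrow> real"
    and u ubar :: "(real ^ 'n) \<times> real \<Rightarrow> real"
  assumes "T > 0"
    and "domain_set \<Omega>"
    and "interior_cone_property \<Omega>"
    and "continuous_on (\<Omega> \<times> UNIV \<times> UNIV \<times> sym_matrices) (\<lambda>(x, r, p, X). H x r p X)"
    and "elliptic_on \<Omega> H"
    and "continuous_on (frontier \<Omega> \<times> UNIV) (\<lambda>(y, r). G y r)"
    and "\<And>\<omega>. modulus_of_continuity \<omega> \<Longrightarrow> (boundary_gap \<Omega> H G \<omega> \<longlongrightarrow> 0) (at_right 0)"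
    and "viscosity_solution \<Omega> T H u"
    and "continuous_on (closure \<Omega> \<times> {0<..<T}) ubar"
    and "\<And>z. z \<in> \<Omega> \<times> {0<..<T} \<Longrightarrow> ubar z = u z"
  shows "(\<forall>\<phi> x0 t0.
           C2_up_to (\<Omega> \<times> {0<..<T}) (closure \<Omega> \<times> {0<..<T}) \<phi> \<and>
           (x0, t0) \<in> frontier \<Omega> \<times> {0<..<T} \<and>
           local_max_on (closure \<Omega> \<times> {0<..<T}) (\<lambda>z. ubar z - \<phi> z) (x0, t0) \<longrightarrow>
           time_deriv \<phi> x0 t0 + G x0 (ubar (x0, t0)) \<le> 0) \<and>
         (\<forall>\<phi> x0 t0.
           C2_up_to (\<Omega> \<times> {0<..<T}) (closure \<Omega> \<times> {0<..<T}) \<phi> \<and>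
           (x0, t0) \<in> frontier \<Omega> \<times> {0<..<T} \<and>
           local_min_on (closure \<Omega> \<times> {0<..<T}) (\<lambda>z. ubar z - \<phi> z) (x0, t0) \<longrightarrow>
           time_deriv \<phi> x0 t0 + G x0 (ubar (x0, t0)) \<ge> 0)"
proof (intro conjI allI impI; elim conjE)
  note gap = assms(7) and visc = assms(8)[unfolded viscosity_solution_def] and ubar = assms(10)
  have "open \<Omega>"
    using assms(2) by (simp add: domain_set_def)
  fix \<phi> :: "(real ^ 'n) \<times> real \<Rightarrow> real" and x0 t0
  assume \<phi>: "C2_up_to (\<Omega> \<times> {0<..<T}) (closure \<Omega> \<times> {0<..<T}) \<phi>"
    and z0: "(x0, t0) \<in> frontier \<Omega> \<times> {0<..<T}"
  {
    assume max: "local_max_on (closure \<Omega> \<times> {0<..<T}) (\<lambda>z. ubar z - \<phi> z) (x0, t0)"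
    \<comment> \<open>The equation is known for \<open>u\<close>, while the lemma needs it for the
      extension \<open>ubar\<close>. Both agree on the cylinder, and local maxima there compare
      values only at its points.\<close>
    have sub: "time_deriv \<psi> y s + H y (ubar (y, s)) (space_grad \<psi> y s) (space_hess \<psi> y s) \<le> 0"
      if "C2_on (\<Omega> \<times> {0<..<T}) \<psi>"
        and m: "local_max_on (\<Omega> \<times> {0<..<T}) (\<lambda>z. ubar z - \<psi> z) (y, s)" for \<psi> y s
    proof -
      have ys: "(y, s) \<in> \<Omega> \<times> {0<..<T}"
        using m by (simp add: local_max_on_def)
      have "local_max_on (\<Omega> \<times> {0<..<T}) (\<lambda>z. u z - \<psi> z) (y, s)"
        unfolding local_max_on_def
      proof
        have "\<forall>\<^sub>F w in at (y, s) within \<Omega> \<times> {0<..<T}. ubar w - \<psi> w \<le> ubar (y, s) - \<psi> (y, s)"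
          using m by (simp add: local_max_on_def)
        moreover have "\<forall>\<^sub>F w in at (y, s) within \<Omega> \<times> {0<..<T}. w \<in> \<Omega> \<times> {0<..<T}"
          by (simp add: eventually_at_filter)
        ultimately show "\<forall>\<^sub>F w in at (y, s) within \<Omega> \<times> {0<..<T}. u w - \<psi> w \<le> u (y, s) - \<psi> (y, s)"
          by eventually_elim (simp only: ubar[OF ys] ubar)
      qed (rule ys)
      with that(1) visc show ?thesis
        unfolding viscosity_subsolution_def ubar[OF ys] by blast
    qed
    show "time_deriv \<phi> x0 t0 + G x0 (ubar (x0, t0)) \<le> 0"
      by (rule boundary_inequality_subsolution[OF \<open>open \<Omega>\<close> assms(3,6) gap sub assms(9) \<phi> _ _ max])
        (use z0 in auto)
  }
  {
    assume min: "local_min_on (closure \<Omega> \<times> {0<..<T}) (\<lambda>z. ubar z - \<phi> z) (x0, t0)"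
    \<comment> \<open>Testing \<open>- ubar\<close> from above with \<psi> amounts to testing
      \<open>u\<close> from below with \<open>- \<psi>\<close>. Changing the sign of the resulting
      supersolution inequality gives a subsolution inequality for \<open>H'\<close>.\<close>
    define H' where "H' x r p X = - H x (- r) (- p) (- X)" for x r p X
    define G' where "G' x r = - G x (- r)" for x r
    have G': "continuous_on (frontier \<Omega> \<times> UNIV) (\<lambda>(y, r). G' y r)"
    proof -
      have "continuous_on (frontier \<Omega> \<times> UNIV) (\<lambda>z. (fst z, - snd z :: real))"
        by (intro continuous_intros)
      then have "continuous_on (frontier \<Omega> \<times> UNIV) (\<lambda>z. case (fst z, - snd z) of (y, r) \<Rightarrow> G y r)"
        by (rule continuous_on_compose2[OF assms(6)]) auto
      then show ?thesis
        unfolding G'_def by (simp add: case_prod_unfold continuous_on_minus)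
    qed
    have gap': "(boundary_gap \<Omega> H' G' \<omega> \<longlongrightarrow> 0) (at_right 0)" if "modulus_of_continuity \<omega>" for \<omega>
      unfolding H'_def G'_def
      by (rule tendsto_sandwich[OF _ _ tendsto_const gap[OF that]])
        (simp_all add: boundary_gap_reflect_le)
    have sub: "time_deriv \<psi> y s + H' y (- ubar (y, s)) (space_grad \<psi> y s) (space_hess \<psi> y s) \<le> 0"
      if \<psi>: "C2_on (\<Omega> \<times> {0<..<T}) \<psi>"
        and m: "local_max_on (\<Omega> \<times> {0<..<T}) (\<lambda>z. - ubar z - \<psi> z) (y, s)" for \<psi> y s
    proof -
      have ys: "(y, s) \<in> \<Omega> \<times> {0<..<T}"
        using m by (simp add: local_max_on_def)
      have "local_min_on (\<Omega> \<times> {0<..<T}) (\<lambda>z. u z - - \<psi> z) (y, s)"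
        unfolding local_min_on_def
      proof
        have "\<forall>\<^sub>F w in at (y, s) within \<Omega> \<times> {0<..<T}. - ubar w - \<psi> w \<le> - ubar (y, s) - \<psi> (y, s)"
          using m by (simp add: local_max_on_def)
        moreover have "\<forall>\<^sub>F w in at (y, s) within \<Omega> \<times> {0<..<T}. w \<in> \<Omega> \<times> {0<..<T}"
          by (simp add: eventually_at_filter)
        ultimately show "\<forall>\<^sub>F w in at (y, s) within \<Omega> \<times> {0<..<T}. u (y, s) - - \<psi> (y, s) \<le> u w - - \<psi> w"
          by eventually_elim (simp add: ubar[OF ys] ubar del: mem_Sigma_iff)
      qed (rule ys)
      moreover have "C2_on (\<Omega> \<times> {0<..<T}) (\<lambda>z. - \<psi> z)"
        using \<psi> unfolding C2_on_def by (rule C2_up_to_minus)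
      ultimately have "time_deriv (\<lambda>z. - \<psi> z) y s + H y (u (y, s)) (space_grad (\<lambda>z. - \<psi> z) y s)
          (space_hess (\<lambda>z. - \<psi> z) y s) \<ge> 0"
        using visc unfolding viscosity_supersolution_def by blast
      then show ?thesis
        using slice_derivatives_minus[OF \<open>open \<Omega>\<close> \<psi>, of y s] ys ubar[OF ys] by (simp add: H'_def)
    qed
    have max: "local_max_on (closure \<Omega> \<times> {0<..<T}) (\<lambda>z. - ubar z - - \<phi> z) (x0, t0)"
      unfolding local_max_on_def
    proof
      have "\<forall>\<^sub>F w in at (x0, t0) within closure \<Omega> \<times> {0<..<T}. ubar (x0, t0) - \<phi> (x0, t0) \<le> ubar w - \<phi> w"
        using min by (simp add: local_min_on_def)
      then show "\<forall>\<^sub>F w in at (x0, t0) within closure \<Omega> \<times> {0<..<T}.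
          - ubar w - - \<phi> w \<le> - ubar (x0, t0) - - \<phi> (x0, t0)"
        by (rule eventually_mono) linarith
    qed (use min in \<open>simp add: local_min_on_def\<close>)
    have "time_deriv (\<lambda>z. - \<phi> z) x0 t0 + G' x0 (- ubar (x0, t0)) \<le> 0"
      by (rule boundary_inequality_subsolution[where u = "\<lambda>z. - ubar z",
            OF \<open>open \<Omega>\<close> assms(3) G' gap' sub continuous_on_minus[OF assms(9)] C2_up_to_minus[OF \<phi>] _ _ max])
        (use z0 in auto)
    moreover have "x0 \<in> closure \<Omega>"
      using z0 by (simp add: frontier_def)
    ultimately show "time_deriv \<phi> x0 t0 + G x0 (ubar (x0, t0)) \<ge> 0"
      using time_deriv_minus_up_to_boundary[OF \<phi>, of x0 t0] z0 by (simp add: G'_def)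
  }
qed

end
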